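(* Fix constants $\delta,\alpha\in(0,1)$, $L>0$, and let $\varphi:[-1,1]\to[0,\infty)$ be a given $L$-Lipschitz convex surrogate. Define $$\kappa=4\sqrt{2}\,L\sqrt{\log\left(\frac{2M}{\delta}\right)},\qquad \alpha_\kappa=\alpha-\frac{\kappa}{\sqrt{n^-}}.$$ Then for any (random, i.e. possibly data-dependent) classifier $h\in\mathcal{H}^{\mathrm{conv}}$ that satisfies $\hat R_\varphi^-(h)\le\alpha_\kappa$, we have $$R^-(h)\le R_\varphi^-(h)\le\alpha$$ with probability at least $1-\delta$. Equivalently, $$\mathbb{P}\left[\mathcal{H}_{n^-}^{\varphi,\alpha_\kappa}\subset\mathcal{H}^{\varphi,\alpha}\right]\ge 1-\delta .$$
   Context: A convex surrogate is a function $\varphi:[-1,1]\to[0,\infty)$ that is non-decreasing, continuous and convex with $\varphi(0)=1$. Let $\mathcal{X}\subset\mathbb{R}^d$, and let $(X,Y)$ be a random pair with $X\in\mathcal{X}$ and $Y\in\{-1,1\}$; $P^-$ denotes the conditional distribution of $X$ given $Y=-1$. A classifier is a (measurable) map $h:\mathcal{X}\to[-1,1]$. Let $h_1,\dots,h_M$, $M\ge2$, be fixed classifiers, let $\Lambda=\{\lambda\in\mathbb{R}^M:\lambda_j\ge0,\ \sum_{j=1}^M\lambda_j=1\}$, $\mathsf{h}_\lambda=\sum_{j=1}^M\lambda_jh_j$, and $\mathcal{H}^{\mathrm{conv}}=\{\mathsf{h}_\lambda:\lambda\in\Lambda\}$. The type I error is $R^-(h)=\mathbb{P}(-Yh(X)\ge0\mid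 Y=-1)=P^-(h(X)\ge 0)$ and the $\varphi$-type I error is $R_\varphi^-(h)=\mathbb{E}[\varphi(-Yh(X))\mid Y=-1]=\mathbb{E}_{X\sim P^-}[\varphi(h(X))]$. Given an i.i.d. sample $X_1^-,\dots,X_{n^-}^-$ from $P^-$, with $n^-\ge1$ deterministic, set $\hat R_\varphi^-(h)=\frac1{n^-}\sum_{i=1}^{n^-}\varphi(h(X_i^-))$. For real $a$, $\mathcal{H}^{\varphi,a}=\{h\in\mathcal{H}^{\mathrm{conv}}:R_\varphi^-(h)\le a\}$ and $\mathcal{H}_{n^-}^{\varphi,a}=\{h\in\mathcal{H}^{\mathrm{conv}}:\hat R_\varphi^-(h)\le a\}$. *)

theory Defs
  imports "HOL-Probability.Probability"
begin

definition convex_surrogate :: "(real \<Rightarrow> real) \<Rightarrow> bool" where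
  "convex_surrogate \<phi> \<longleftrightarrow>
     \<phi> \<in> {-1..1} \<rightarrow> {0..} \<and> mono_on {-1..1} \<phi> \<and> continuous_on {-1..1} \<phi> \<and>
     convex_on {-1..1} \<phi> \<and> \<phi> 0 = 1"

(* The feature domain \<X> is an arbitrary subset of R^d carrying the trace of the Borel
   sigma-algebra.  Functions on \<X> are HOL functions on all of R^d whose values outside
   \<X> are irrelevant. *)

abbreviation feature_space :: "(real ^ 'd) set \<Rightarrow> (real ^ 'd) measure" where
  "feature_space \<X> \<equiv> restrict_space borel \<X>"

definition classifier :: "(real ^ 'd) set \<Rightarrow> (real ^ 'd \<Rightarrow> real) \<Rightarrow> bool" where
  "classifier \<X> h \<longleftrightarrow> h \<in> borel_measurable (feature_space \<X>) \<and> h \<in> \<X> \<rightarrow> {-1..1}"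

definition simplex_weights :: "nat \<Rightarrow> (nat \<Rightarrow> real) set" where
  "simplex_weights m = {w. (\<forall>j\<in>{1..m}. 0 \<le> w j) \<and> (\<Sum>j=1..m. w j) = 1}"

definition conv_comb :: "nat \<Rightarrow> (nat \<Rightarrow> 'x \<Rightarrow> real) \<Rightarrow> (nat \<Rightarrow> real) \<Rightarrow> 'x \<Rightarrow> real" where
  "conv_comb m h w = (\<lambda>x. \<Sum>j=1..m. w j * h j x)"

definition H_conv :: "nat \<Rightarrow> (nat \<Rightarrow> 'x \<Rightarrow> real) \<Rightarrow> ('x \<Rightarrow> real) set" where
  "H_conv m h = conv_comb m h ` simplex_weights m"

(* Conditioning on the event Y = -1: uniform_measure N A is the measure
   B \<mapsto> N (A \<inter> B) / N A, i.e. the conditional probability given A when N A > 0. *)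

definition given_neg :: "'w measure \<Rightarrow> ('w \<Rightarrow> real) \<Rightarrow> 'w measure" where
  "given_neg N Y = uniform_measure N {\<omega> \<in> space N. Y \<omega> = -1}"

definition P_neg ::
  "(real ^ 'd) set \<Rightarrow> 'w measure \<Rightarrow> ('w \<Rightarrow> real ^ 'd) \<Rightarrow> ('w \<Rightarrow> real) \<Rightarrow> (real ^ 'd) measure" where
  "P_neg \<X> N X Y = distr (given_neg N Y) (feature_space \<X>) X"

definition type1_error ::
  "'w measure \<Rightarrow> ('w \<Rightarrow> 'x) \<Rightarrow> ('w \<Rightarrow> real) \<Rightarrow> ('x \<Rightarrow> real) \<Rightarrow> real" where
  "type1_error N X Y h = \<P>(\<omega> in N. - Y \<omega> * h (X \<omega>) \<ge> 0 \<bar> Y \<omega> = -1)"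

definition phi_type1_error ::
  "(real \<Rightarrow> real) \<Rightarrow> 'w measure \<Rightarrow> ('w \<Rightarrow> 'x) \<Rightarrow> ('w \<Rightarrow> real) \<Rightarrow> ('x \<Rightarrow> real) \<Rightarrow> real" where
  "phi_type1_error \<phi> N X Y h = (\<integral>\<omega>. \<phi> (- Y \<omega> * h (X \<omega>)) \<partial>given_neg N Y)"

definition emp_phi_type1_error ::
  "(real \<Rightarrow> real) \<Rightarrow> nat \<Rightarrow> (nat \<Rightarrow> 'x) \<Rightarrow> ('x \<Rightarrow> real) \<Rightarrow> real" where
  "emp_phi_type1_error \<phi> n s h = (\<Sum>i=1..n. \<phi> (h (s i))) / real n"

definition H_phi ::
  "(real \<Rightarrow> real) \<Rightarrow> 'w measure \<Rightarrow> ('w \<Rightarrow> 'x) \<Rightarrow> ('w \<Rightarrow> real) \<Rightarrow> nat \<Rightarrow>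
   (nat \<Rightarrow> 'x \<Rightarrow> real) \<Rightarrow> real \<Rightarrow> ('x \<Rightarrow> real) set" where
  "H_phi \<phi> N X Y m h a = {g \<in> H_conv m h. phi_type1_error \<phi> N X Y g \<le> a}"

definition H_phi_emp ::
  "(real \<Rightarrow> real) \<Rightarrow> nat \<Rightarrow> (nat \<Rightarrow> 'x) \<Rightarrow> nat \<Rightarrow>
   (nat \<Rightarrow> 'x \<Rightarrow> real) \<Rightarrow> real \<Rightarrow> ('x \<Rightarrow> real) set" where
  "H_phi_emp \<phi> n s m h a = {g \<in> H_conv m h. emp_phi_type1_error \<phi> n s g \<le> a}"

definition iid_sample :: "'w measure \<Rightarrow> 'x measure \<Rightarrow> nat \<Rightarrow> (nat \<Rightarrow> 'w \<Rightarrow> 'x) \<Rightarrow> bool" where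
  "iid_sample N D n S \<longleftrightarrow>
     prob_space.indep_vars N (\<lambda>_. D) S {1..n} \<and> (\<forall>i\<in>{1..n}. distr N D (S i) = D)"

definition kappa :: "real \<Rightarrow> nat \<Rightarrow> real \<Rightarrow> real" where
  "kappa L m \<delta> = 4 * sqrt 2 * L * sqrt (ln (2 * real m / \<delta>))"

definition alpha_kappa :: "real \<Rightarrow> real \<Rightarrow> nat \<Rightarrow> real \<Rightarrow> nat \<Rightarrow> real" where
  "alpha_kappa \<alpha> L m \<delta> n = \<alpha> - kappa L m \<delta> / sqrt (real n)"

(* The descriptions of the two errors through the conditional law of X given Y = -1. *)

lemma
  fixes X :: "'w \<Rightarrow> real ^ 'd"
  assumes "prob_space N"
    and X: "X \<in> measurable N (feature_space \<X>)"
    and Y: "Y \<in> measurable N (count_space {-1, 1})"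
    and pos: "measure N {\<omega> \<in> space N. Y \<omega> = -1} > 0"
    and h: "classifier \<X> h"
  shows type1_error_eq_P_neg:
      "type1_error N X Y h = measure (P_neg \<X> N X Y) {x \<in> \<X>. h x \<ge> 0}"
    and phi_type1_error_eq_P_neg:
      "convex_surrogate \<phi> \<Longrightarrow>
       phi_type1_error \<phi> N X Y h = (\<integral>x. \<phi> (h x) \<partial>P_neg \<X> N X Y)"
proof -
  interpret prob_space N by fact
  let ?A = "{\<omega> \<in> space N. Y \<omega> = -1}"
  have hm: "h \<in> borel_measurable (feature_space \<X>)" and hr: "\<And>x. x \<in> \<X> \<Longrightarrow> h x \<in> {-1..1}"
    using h by (auto simp: classifier_def)
  have XX: "X \<omega> \<in> \<X>" if "\<omega> \<in> space N" for \<omega>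
    using measurable_space[OF X that] by (auto simp: space_restrict_space)
  have A: "?A \<in> sets N"
    using measurable_sets[OF Y, of "{-1}"] by (simp add: vimage_def Int_def conj_commute)
  have posE: "emeasure N ?A \<noteq> 0" "emeasure N ?A \<noteq> \<infinity>"
    using pos by (auto simp: emeasure_eq_measure)
  have Xg: "X \<in> measurable (given_neg N Y) (feature_space \<X>)"
    using X by (simp add: given_neg_def)
  have S: "{x \<in> \<X>. h x \<ge> 0} \<in> sets (feature_space \<X>)"
    using measurable_sets[OF hm, of "{0..}"]
    by (simp add: vimage_def Int_def space_restrict_space conj_commute)
  have pre: "X -` {x \<in> \<X>. h x \<ge> 0} \<inter> space N = {\<omega> \<in> space N. h (X \<omega>) \<ge> 0}"
    using XX by blast
  have B: "{\<omega> \<in> space N. h (X \<omega>) \<ge> 0} \<in> sets N"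
    using measurable_sets[OF X S] by (simp only: pre)
  have AB: "{\<omega> \<in> space N. - Y \<omega> * h (X \<omega>) \<ge> 0 \<and> Y \<omega> = -1} = ?A \<inter> {\<omega> \<in> space N. h (X \<omega>) \<ge> 0}"
    (is "?l = ?r")
  proof (rule set_eqI)
    fix \<omega>
    show "\<omega> \<in> ?l \<longleftrightarrow> \<omega> \<in> ?r"
      by (cases "Y \<omega> = -1") simp_all
  qed
  have "measure (P_neg \<X> N X Y) {x \<in> \<X>. h x \<ge> 0}
      = measure (uniform_measure N ?A) {\<omega> \<in> space N. h (X \<omega>) \<ge> 0}"
    unfolding P_neg_def measure_distr[OF Xg S] by (simp only: given_neg_def space_uniform_measure pre)
  also have "\<dots> = type1_error N X Y h"
    unfolding measure_uniform_measure[OF posE B] type1_error_def cond_prob_def AB ..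
  finally show "type1_error N X Y h = measure (P_neg \<X> N X Y) {x \<in> \<X>. h x \<ge> 0}" ..
  assume phi: "convex_surrogate \<phi>"
  have phim: "\<phi> \<in> borel_measurable (restrict_space borel {-1..1})"
    using phi by (intro borel_measurable_continuous_on_restrict) (simp add: convex_surrogate_def)
  have "h \<in> measurable (feature_space \<X>) (restrict_space borel {-1..1})"
    using hm hr by (intro measurable_restrict_space2) (auto simp: space_restrict_space)
  from measurable_compose[OF this phim]
  have ph: "(\<lambda>x. \<phi> (h x)) \<in> borel_measurable (feature_space \<X>)" .
  have Ym: "Y \<in> borel_measurable N"
    using measurable_compose[OF Y, of "\<lambda>y. y" borel] by simp
  have "phi_type1_error \<phi> N X Y h = (\<integral>\<omega>. \<phi> (h (X \<omega>)) \<partial>given_neg N Y)"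
    unfolding phi_type1_error_def
  proof (rule integral_cong_AE)
    have "(\<lambda>\<omega>. - Y \<omega> * h (X \<omega>)) \<in> measurable N (restrict_space borel {-1..1})"
    proof (rule measurable_restrict_space2)
      show "(\<lambda>\<omega>. - Y \<omega> * h (X \<omega>)) \<in> space N \<rightarrow> {-1..1}"
      proof
        fix \<omega> assume w: "\<omega> \<in> space N"
        have "Y \<omega> = -1 \<or> Y \<omega> = 1"
          using measurable_space[OF Y w] by simp
        then show "- Y \<omega> * h (X \<omega>) \<in> {-1..1}"
          using hr[OF XX[OF w]] by (elim disjE) simp_all
      qed
      show "(\<lambda>\<omega>. - Y \<omega> * h (X \<omega>)) \<in> borel_measurable N"
        using Ym measurable_compose[OF X hm] by simp
    qed
    from measurable_compose[OF this phim]
    show "(\<lambda>\<omega>. \<phi> (- Y \<omega> * h (X \<omega>))) \<in> borel_measurable (given_neg N Y)"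
      by (simp add: given_neg_def)
    show "(\<lambda>\<omega>. \<phi> (h (X \<omega>))) \<in> borel_measurable (given_neg N Y)"
      using measurable_compose[OF X ph] by (simp add: given_neg_def)
    show "AE \<omega> in given_neg N Y. \<phi> (- Y \<omega> * h (X \<omega>)) = \<phi> (h (X \<omega>))"
      unfolding given_neg_def by (rule AE_uniform_measureI[OF A]) auto
  qed
  also have "\<dots> = (\<integral>x. \<phi> (h x) \<partial>P_neg \<X> N X Y)"
    unfolding P_neg_def by (rule integral_distr[OF Xg ph, symmetric])
  finally show "phi_type1_error \<phi> N X Y h = (\<integral>x. \<phi> (h x) \<partial>P_neg \<X> N X Y)" .
qed

end

theory Submission
  imports Defs
begin

text \<open>
  The deviation \<open>R - R'\<close> between the true and the empirical \<open>\<phi>\<close>-error is Lipschitz in the weights, so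
  it suffices to control it on a finite net of the simplex; the constant \<open>\<kappa>\<close> is twice what the net
  requires. On the net, one bounds the moment generating function of the maximal deviation. Integrating
  out one sample point at a time, symmetrization and the Ledoux--Talagrand contraction replace the
  increment \<open>E \<phi>(h(X)) - \<phi>(h(X))\<close> by \<open>\<plusminus> 2 L h(X)\<close> with a random sign. The new increment is linear in
  the weights, so after the last step the maximum over the simplex is bounded by the sum over its
  vertices, and each vertex contributes a product of factors \<open>cosh\<close>. Markov's inequality with the
  optimal parameter finishes the estimate.

  The inclusion event has to be shown measurable, since \<^const>\<open>measure\<close> is zero on non-measurable sets:
  by compactness of the simplex it is described by countably many weights.
\<close>

section \<open>Exponential inequalities and contraction for one random sign\<close>

text \<open>The left-hand side is the moment generating function of a fair sign, so this is the
  price of one sample point after symmetrization. Evenness of \<open>cosh\<close> reduces it to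
  nonnegative arguments.\<close>

lemma cosh_le_exp_square_half:
  fixes x :: real
  shows "cosh x \<le> exp (x\<^sup>2 / 2)"
proof -
  have *: "cosh y \<le> exp (y\<^sup>2 / 2)" if "y \<ge> 0" for y :: real
  proof -
    \<comment> \<open>Hoeffding's bound for a centred Bernoulli variable with success probability
      \<open>1 / 2\<close> and jump \<open>2 * y\<close>, that is, for the two values
      \<open>y\<close> and \<open>- y\<close>.\<close>
    have "- y + ln (1 + (exp (2 * y) - 1) / 2) \<le> y\<^sup>2 / 2"
      using Hoeffdings_lemma_aux[of "2 * y" "1 / 2"] that by (simp add: power2_eq_square)
    moreover have "1 + (exp (2 * y) - 1) / 2 = exp y * cosh y"
      by (simp add: cosh_def field_simps flip: exp_add)
    ultimately have "ln (cosh y) \<le> y\<^sup>2 / 2"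
      by (simp add: ln_mult cosh_real_pos)
    then show ?thesis
      using cosh_real_pos[of y] by (metis exp_le_cancel_iff exp_ln)
  qed
  show ?thesis
    using *[of "\<bar>x\<bar>"] by simp
qed

text \<open>The increment of \<open>exp\<close> factors as \<open>exp b * (exp t - 1)\<close>, a
  product of nonnegative monotone factors. This is convexity of \<open>exp\<close> in the form that
  the contraction uses.\<close>

lemma exp_diff_mono:
  fixes a b s t :: real
  assumes "b \<le> a" "t \<le> s" "0 \<le> t"
  shows "exp (b + t) - exp b \<le> exp (a + s) - exp a"
proof -
  have "exp b * (exp t - 1) \<le> exp a * (exp s - 1)"
    using assms by (intro mult_mono) auto
  then show ?thesis
    by (simp add: exp_add algebra_simps)
qed

text \<open>With opposite signs of \<open>u1\<close> and \<open>u2\<close> each summand is dominated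
  on its own. With equal signs one summand grows while the other shrinks, and
  \<open>exp_diff_mono\<close> compares gain and loss: the Lipschitz hypothesis orders the step
  lengths, while the hypotheses \<open>max\<close> and the size bounds order the base points. Which
  sign pairing dominates depends on the case, hence the maximum on the right.\<close>

lemma exp_contraction_aux:
  fixes a1 a2 u1 u2 p1 p2 :: real
  assumes u: "0 \<le> u1 \<or> 0 \<le> u2"
    and p: "\<bar>p1\<bar> \<le> \<bar>u1\<bar>" "\<bar>p2\<bar> \<le> \<bar>u2\<bar>" "\<bar>p1 - p2\<bar> \<le> \<bar>u1 - u2\<bar>"
    and max: "a2 + p2 \<le> a1 + p1" "a1 - p1 \<le> a2 - p2"
  shows "exp (a1 + p1) + exp (a2 - p2)
     \<le> max (exp (a1 + u1) + exp (a2 - u2)) (exp (a2 + u2) + exp (a1 - u1))"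
proof -
  consider "0 \<le> u1" "u2 \<le> 0" | "u1 \<le> 0" "0 \<le> u2" | "0 \<le> u2" "u2 \<le> u1" | "0 \<le> u1" "u1 \<le> u2"
    using u by linarith
  then show ?thesis
  proof cases
    case 1
    then have "exp (a1 + p1) + exp (a2 - p2) \<le> exp (a1 + u1) + exp (a2 - u2)"
      using p by (intro add_mono) auto
    then show ?thesis by linarith
  next
    case 2
    then have "exp (a1 + p1) + exp (a2 - p2) \<le> exp (a1 - u1) + exp (a2 + u2)"
      using p by (intro add_mono) auto
    then show ?thesis by linarith
  next
    case 3
    then have "exp (a2 - p2) - exp (a2 - u2) \<le> exp (a1 + u1) - exp (a1 + p1)"
      using exp_diff_mono[of "a2 - u2" "a1 + p1" "u2 - p2" "u1 - p1"] p max by auto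
    then show ?thesis by linarith
  next
    case 4
    then have "exp (a1 + p1) - exp (a1 - u1) \<le> exp (a2 + u2) - exp (a2 - p2)"
      using exp_diff_mono[of "a1 - u1" "a2 - p2" "u1 + p1" "u2 + p2"] p max by auto
    then show ?thesis by linarith
  qed
qed

lemma exp_contraction:
  fixes a1 a2 u1 u2 p1 p2 :: real
  assumes p: "\<bar>p1\<bar> \<le> \<bar>u1\<bar>" "\<bar>p2\<bar> \<le> \<bar>u2\<bar>" "\<bar>p1 - p2\<bar> \<le> \<bar>u1 - u2\<bar>"
    and max: "a2 + p2 \<le> a1 + p1" "a1 - p1 \<le> a2 - p2"
  shows "exp (a1 + p1) + exp (a2 - p2)
     \<le> max (exp (a1 + u1) + exp (a2 - u2)) (exp (a2 + u2) + exp (a1 - u1))"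
proof (cases "0 \<le> u1 \<or> 0 \<le> u2")
  case True
  then show ?thesis
    using p max by (rule exp_contraction_aux)
next
  case False
  \<comment> \<open>Negating both \<open>u1\<close> and \<open>u2\<close> preserves the hypotheses
    on \<open>p1\<close> and \<open>p2\<close> and merely swaps the two entries of the
    maximum.\<close>
  then show ?thesis
    using exp_contraction_aux[of "- u1" "- u2" p1 p2 a2 a1] p max by (simp add: max.commute add.commute)
qed

text \<open>Contraction averaged over one sign, up to the factor \<open>1 / 2\<close>. The two
  maximisers on the left satisfy the optimality hypotheses of \<open>exp_contraction\<close>, and
  either sign pairing there is at most the sum of the two maxima on the right.\<close>

lemma Max_exp_contraction:
  fixes a p u :: "'t \<Rightarrow> real"
  assumes T: "finite T" "T \<noteq> {}"
    and p: "\<And>w. w \<in> T \<Longrightarrow> \<bar>p w\<bar> \<le> \<bar>u w\<bar>"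
      "\<And>w v. w \<in> T \<Longrightarrow> v \<in> T \<Longrightarrow> \<bar>p w - p v\<bar> \<le> \<bar>u w - u v\<bar>"
  shows "(MAX w\<in>T. exp (a w + p w)) + (MAX w\<in>T. exp (a w - p w))
     \<le> (MAX w\<in>T. exp (a w + u w)) + (MAX w\<in>T. exp (a w - u w))"
proof -
  have ub: "f w \<le> (MAX w\<in>T. f w)" if "w \<in> T" for f :: "'t \<Rightarrow> real" and w
    using T that by simp
  have "(MAX w\<in>T. exp (a w + p w)) \<in> (\<lambda>w. exp (a w + p w)) ` T"
    using T by (intro Max_in) auto
  then obtain w1 where w1: "w1 \<in> T" "(MAX w\<in>T. exp (a w + p w)) = exp (a w1 + p w1)"
    by auto
  have "(MAX w\<in>T. exp (a w - p w)) \<in> (\<lambda>w. exp (a w - p w)) ` T"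
    using T by (intro Max_in) auto
  then obtain w2 where w2: "w2 \<in> T" "(MAX w\<in>T. exp (a w - p w)) = exp (a w2 - p w2)"
    by auto
  have "a w2 + p w2 \<le> a w1 + p w1" "a w1 - p w1 \<le> a w2 - p w2"
    using ub[OF w2(1), of "\<lambda>w. exp (a w + p w)"] ub[OF w1(1), of "\<lambda>w. exp (a w - p w)"] w1 w2
    by auto
  from exp_contraction[OF p(1)[OF w1(1)] p(1)[OF w2(1)] p(2)[OF w1(1) w2(1)] this]
  show ?thesis
    unfolding w1(2) w2(2)
    using ub[OF w1(1), of "\<lambda>w. exp (a w + u w)"] ub[OF w2(1), of "\<lambda>w. exp (a w + u w)"]
      ub[OF w1(1), of "\<lambda>w. exp (a w - u w)"] ub[OF w2(1), of "\<lambda>w. exp (a w - u w)"]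
    by linarith
qed

section \<open>Symmetrization, the moment generating function of the maximal deviation, and the tail
  bound\<close>

lemma (in prob_space) exp_expectation_le:
  fixes f :: "'a \<Rightarrow> real"
  assumes [measurable]: "f \<in> borel_measurable M" and f: "\<And>x. x \<in> space M \<Longrightarrow> \<bar>f x\<bar> \<le> B"
  shows "exp (expectation f) \<le> expectation (\<lambda>x. exp (f x))"
proof (rule jensens_inequality[where q = exp and X = f and I = UNIV])
  show "integrable M f"
    using f by (intro integrable_const_bound[where B = B]) auto
  show "integrable M (\<lambda>x. exp (f x))"
    using f by (intro integrable_const_bound[where B = "exp B"]) (auto intro: order_trans[OF abs_ge_self])
  show "convex_on UNIV (exp :: real \<Rightarrow> real)"
    using convex_on_exp[of 1] by simp
qed auto

text \<open>
  No ghost sample is needed: \<open>a + E p - p x\<close> is the midpoint of \<open>a + 2 E p\<close> and \<open>a - 2 p x\<close>, so convexity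
  of \<open>exp\<close> separates the two terms, and Jensen's inequality moves \<open>E\<close> out of the first.
\<close>

lemma (in prob_space) symmetrization_step:
  fixes a :: "'t \<Rightarrow> real" and p u :: "'t \<Rightarrow> 'a \<Rightarrow> real"
  assumes T: "finite T" "T \<noteq> {}"
    and [measurable]: "\<And>w. w \<in> T \<Longrightarrow> p w \<in> borel_measurable M"
      "\<And>w. w \<in> T \<Longrightarrow> u w \<in> borel_measurable M"
    and u: "\<And>w x. w \<in> T \<Longrightarrow> x \<in> space M \<Longrightarrow> \<bar>u w x\<bar> \<le> B"
    and p: "\<And>w x. w \<in> T \<Longrightarrow> x \<in> space M \<Longrightarrow> \<bar>p w x\<bar> \<le> \<bar>u w x\<bar>"
      "\<And>w v x. w \<in> T \<Longrightarrow> v \<in> T \<Longrightarrow> x \<in> space M \<Longrightarrow> \<bar>p w x - p v x\<bar> \<le> \<bar>u w x - u v x\<bar>"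
  shows "(\<integral>\<^sup>+x. ennreal (MAX w\<in>T. exp (a w + (expectation (p w) - p w x))) \<partial>M)
     \<le> (\<integral>\<^sup>+x. ennreal (((MAX w\<in>T. exp (a w + 2 * u w x)) + (MAX w\<in>T. exp (a w - 2 * u w x))) / 2) \<partial>M)"
proof -
  have ub: "f w \<le> (MAX w\<in>T. f w)" if "w \<in> T" for f :: "'t \<Rightarrow> real" and w
    using T that by simp
  have bdd: "\<bar>MAX w\<in>T. exp (f w)\<bar> \<le> exp C" if "\<And>w. w \<in> T \<Longrightarrow> f w \<le> C" for f :: "'t \<Rightarrow> real" and C
  proof -
    have "(MAX w\<in>T. exp (f w)) \<in> (\<lambda>w. exp (f w)) ` T"
      using T by (intro Max_in) auto
    then show ?thesis
      using that by auto
  qed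
  define A where "A = (\<Sum>w\<in>T. \<bar>a w\<bar>)"
  have A: "\<bar>a w\<bar> \<le> A" if "w \<in> T" for w
    unfolding A_def using T that by (intro member_le_sum) auto
  have pB: "\<bar>p w x\<bar> \<le> B" if "w \<in> T" "x \<in> space M" for w x
    using p(1)[OF that] u[OF that] by linarith
  have int: "integrable M (\<lambda>x. MAX w\<in>T. exp (a w + f w x))"
    if [measurable]: "\<And>w. w \<in> T \<Longrightarrow> f w \<in> borel_measurable M"
      and f: "\<And>w x. w \<in> T \<Longrightarrow> x \<in> space M \<Longrightarrow> \<bar>f w x\<bar> \<le> C" for f :: "'t \<Rightarrow> 'a \<Rightarrow> real" and C
  proof (rule integrable_const_bound)
    show "AE x in M. norm (MAX w\<in>T. exp (a w + f w x)) \<le> exp (A + C)"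
      unfolding real_norm_def
    proof (intro AE_I2 bdd)
      fix x w assume "x \<in> space M" "w \<in> T"
      then show "a w + f w x \<le> A + C"
        using f[of w x] A[of w] by linarith
    qed
    show "(\<lambda>x. MAX w\<in>T. exp (a w + f w x)) \<in> borel_measurable M"
      using T by measurable
  qed
  have intp: "integrable M (p w)" if "w \<in> T" for w
    using pB[OF that] that by (intro integrable_const_bound[where B = B]) auto
  have pos: "integrable M (\<lambda>x. MAX w\<in>T. exp (a w + 2 * p w x))"
    using int[of "\<lambda>w x. 2 * p w x" "2 * B"] pB by (auto simp: abs_mult)
  have neg: "integrable M (\<lambda>x. MAX w\<in>T. exp (a w - 2 * p w x))"
    using int[of "\<lambda>w x. - (2 * p w x)" "2 * B"] pB by (auto simp: abs_mult)
  have upos: "integrable M (\<lambda>x. MAX w\<in>T. exp (a w + 2 * u w x))"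
    using int[of "\<lambda>w x. 2 * u w x" "2 * B"] u by (auto simp: abs_mult)
  have uneg: "integrable M (\<lambda>x. MAX w\<in>T. exp (a w - 2 * u w x))"
    using int[of "\<lambda>w x. - (2 * u w x)" "2 * B"] u by (auto simp: abs_mult)
  \<comment> \<open>\<open>E\<close> does not depend on the weight, so it bounds the first of the
    two separated terms for all weights at once.\<close>
  define E where "E = expectation (\<lambda>x. MAX w\<in>T. exp (a w + 2 * p w x))"
  have E: "exp (a w + 2 * expectation (p w)) \<le> E" if w: "w \<in> T" for w
  proof -
    have "exp (expectation (\<lambda>x. a w + 2 * p w x)) \<le> expectation (\<lambda>x. exp (a w + 2 * p w x))"
    proof (rule exp_expectation_le)
      show "\<bar>a w + 2 * p w x\<bar> \<le> A + 2 * B" if "x \<in> space M" for x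
        using A[OF w] pB[OF w that] by linarith
    qed (use w in measurable)
    also have "\<dots> \<le> E"
      unfolding E_def
    proof (rule integral_mono[OF _ pos])
      show "integrable M (\<lambda>x. exp (a w + 2 * p w x))"
      proof (rule integrable_const_bound[where B = "exp (A + 2 * B)"])
        have "a w + 2 * p w x \<le> A + 2 * B" if "x \<in> space M" for x
          using A[OF w] pB[OF w that] by linarith
        then show "AE x in M. norm (exp (a w + 2 * p w x)) \<le> exp (A + 2 * B)"
          by auto
      qed (use w in measurable)
    qed (rule ub[OF w])
    also have "expectation (\<lambda>x. a w + 2 * p w x) = a w + 2 * expectation (p w)"
      using intp[OF w] by (simp add: prob_space)
    finally show ?thesis .
  qed
  have split: "(MAX w\<in>T. exp (a w + (expectation (p w) - p w x)))
      \<le> (E + (MAX w\<in>T. exp (a w - 2 * p w x))) / 2" (is "?l \<le> ?r") for x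
  proof -
    have "exp (a w + (expectation (p w) - p w x)) \<le> ?r" if w: "w \<in> T" for w
    proof -
      have "exp ((r + s) / 2) \<le> (exp r + exp s) / 2" for r s :: real
      proof -
        have "0 \<le> (exp (r / 2) - exp (s / 2))\<^sup>2"
          by simp
        also have "\<dots> = exp r + exp s - 2 * exp ((r + s) / 2)"
          by (simp add: power2_eq_square algebra_simps add_divide_distrib flip: exp_add)
        finally show ?thesis by simp
      qed
      moreover have "(a w + 2 * expectation (p w) + (a w - 2 * p w x)) / 2 = a w + (expectation (p w) - p w x)"
        by simp
      ultimately have "exp (a w + (expectation (p w) - p w x))
          \<le> (exp (a w + 2 * expectation (p w)) + exp (a w - 2 * p w x)) / 2"
        by metis
      also have "\<dots> \<le> ?r"
        using E[OF w] ub[OF w, of "\<lambda>w. exp (a w - 2 * p w x)"] by simp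
      finally show ?thesis .
    qed
    then show ?thesis
      using T by (subst Max_le_iff) auto
  qed
  have "(\<integral>\<^sup>+x. ennreal (MAX w\<in>T. exp (a w + (expectation (p w) - p w x))) \<partial>M)
      \<le> (\<integral>\<^sup>+x. ennreal ((E + (MAX w\<in>T. exp (a w - 2 * p w x))) / 2) \<partial>M)"
    by (intro nn_integral_mono ennreal_leI split)
  also have "\<dots> = ennreal (\<integral>x. (E + (MAX w\<in>T. exp (a w - 2 * p w x))) / 2 \<partial>M)"
  proof (rule nn_integral_eq_integral)
    show "AE x in M. 0 \<le> (E + (MAX w\<in>T. exp (a w - 2 * p w x))) / 2"
      using split T by (intro AE_I2) (meson all_not_in_conv exp_ge_zero order_trans ub)
  qed (use neg in simp)
  \<comment> \<open>Since \<open>E\<close> is itself the integral of the maximum with the plus sign,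
    linearity puts both signs under one integral, where the contraction applies pointwise.\<close>
  also have "(\<integral>x. (E + (MAX w\<in>T. exp (a w - 2 * p w x))) / 2 \<partial>M)
      = (\<integral>x. ((MAX w\<in>T. exp (a w + 2 * p w x)) + (MAX w\<in>T. exp (a w - 2 * p w x))) / 2 \<partial>M)"
    using pos neg by (simp add: E_def prob_space)
  also have "ennreal \<dots>
      \<le> ennreal (\<integral>x. ((MAX w\<in>T. exp (a w + 2 * u w x)) + (MAX w\<in>T. exp (a w - 2 * u w x))) / 2 \<partial>M)"
  proof (intro ennreal_leI integral_mono divide_right_mono)
    fix x assume x: "x \<in> space M"
    show "(MAX w\<in>T. exp (a w + 2 * p w x)) + (MAX w\<in>T. exp (a w - 2 * p w x))
        \<le> (MAX w\<in>T. exp (a w + 2 * u w x)) + (MAX w\<in>T. exp (a w - 2 * u w x))"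
    proof (rule Max_exp_contraction[OF T])
      fix w v assume wv: "w \<in> T" "v \<in> T"
      show "\<bar>2 * p w x - 2 * p v x\<bar> \<le> \<bar>2 * u w x - 2 * u v x\<bar>"
        using p(2)[OF wv x] by linarith
    qed (use p(1) x in \<open>auto simp: abs_mult\<close>)
  qed (use pos neg upos uneg in auto)
  also have "\<dots> = (\<integral>\<^sup>+x. ennreal (((MAX w\<in>T. exp (a w + 2 * u w x)) + (MAX w\<in>T. exp (a w - 2 * u w x))) / 2) \<partial>M)"
  proof (rule nn_integral_eq_integral[symmetric])
    have "0 \<le> (MAX w\<in>T. exp (f w))" for f :: "'t \<Rightarrow> real"
      using T ub by (meson all_not_in_conv exp_ge_zero order_trans)
    then show "AE x in M. 0 \<le> ((MAX w\<in>T. exp (a w + 2 * u w x)) + (MAX w\<in>T. exp (a w - 2 * u w x))) / 2"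
      by simp
  qed (use upos uneg in simp)
  finally show ?thesis .
qed

text \<open>
  The linear term with an arbitrary vector \<open>b\<close> makes the induction over the sample work: it absorbs the
  increments \<open>\<plusminus> 2 c h(y)\<close> produced by the symmetrization step.
\<close>

lemma (in prob_space) nn_integral_PiM_Max_exp_le:
  fixes p :: "('j \<Rightarrow> real) \<Rightarrow> 'a \<Rightarrow> real" and h :: "'j \<Rightarrow> 'a \<Rightarrow> real"
  assumes T: "finite T" "T \<noteq> {}" and J: "finite J"
    and w: "\<And>w j. w \<in> T \<Longrightarrow> j \<in> J \<Longrightarrow> 0 \<le> w j" "\<And>w. w \<in> T \<Longrightarrow> (\<Sum>j\<in>J. w j) = 1"
    and pm[measurable]: "\<And>w. w \<in> T \<Longrightarrow> p w \<in> borel_measurable M"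
    and hm[measurable]: "\<And>j. j \<in> J \<Longrightarrow> h j \<in> borel_measurable M"
    and h: "\<And>j x. j \<in> J \<Longrightarrow> x \<in> space M \<Longrightarrow> \<bar>h j x\<bar> \<le> 1"
    and c: "0 \<le> c"
    and p: "\<And>w x. w \<in> T \<Longrightarrow> x \<in> space M \<Longrightarrow> \<bar>p w x\<bar> \<le> c * \<bar>\<Sum>j\<in>J. w j * h j x\<bar>"
      "\<And>w v x. w \<in> T \<Longrightarrow> v \<in> T \<Longrightarrow> x \<in> space M \<Longrightarrow>
         \<bar>p w x - p v x\<bar> \<le> c * \<bar>(\<Sum>j\<in>J. w j * h j x) - (\<Sum>j\<in>J. v j * h j x)\<bar>"
    and I: "finite (I :: 'i set)"
  shows "(\<integral>\<^sup>+x. ennreal (MAX w\<in>T. exp ((\<Sum>j\<in>J. w j * b j)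
            + (\<Sum>i\<in>I. expectation (p w) - p w (x i)))) \<partial>(\<Pi>\<^sub>M i\<in>I. M))
     \<le> ennreal ((\<Sum>j\<in>J. exp (b j)) * exp (2 * c\<^sup>2) ^ card I)"
  using I
proof (induction I arbitrary: b rule: finite_induct)
  case empty
  \<comment> \<open>With no sample point left the exponent is linear in the weights: convexity
    bounds it by a weighted average over the vertices, and each weight is at most 1.\<close>
  have "exp (\<Sum>j\<in>J. w j * b j) \<le> (\<Sum>j\<in>J. exp (b j))" if wT: "w \<in> T" for w
  proof -
    have "J \<noteq> {}"
      using w(2)[OF wT] by auto
    then have "exp (\<Sum>j\<in>J. w j *\<^sub>R b j) \<le> (\<Sum>j\<in>J. w j * exp (b j))"
      using convex_on_exp[of 1] J w wT
      by (intro convex_on_sum[where C = UNIV]) auto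
    also have "\<dots> \<le> (\<Sum>j\<in>J. exp (b j))"
    proof (rule sum_mono)
      fix j assume j: "j \<in> J"
      have "w j \<le> (\<Sum>j\<in>J. w j)"
        using J w(1)[OF wT] j by (intro member_le_sum) auto
      then show "w j * exp (b j) \<le> exp (b j)"
        using w(2)[OF wT] by simp
    qed
    finally show ?thesis by simp
  qed
  then have "(MAX w\<in>T. exp (\<Sum>j\<in>J. w j * b j)) \<le> (\<Sum>j\<in>J. exp (b j))"
    using T by (subst Max_le_iff) auto
  then show ?case
    by (simp add: PiM_empty nn_integral_count_space_finite ennreal_leI)
next
  case (insert i I)
  interpret P: product_sigma_finite "\<lambda>_ :: 'i. M"
    by standard
  note [simp] = insert.hyps
  define lin where "lin = (\<lambda>b (w :: 'j \<Rightarrow> real). \<Sum>j\<in>J. w j * b j :: real)"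
  define D where "D = (\<lambda>w x. \<Sum>i\<in>I. expectation (p w) - p w (x i))"
  define u where "u = (\<lambda>w y. c * lin (\<lambda>j. h j y) w)"
  define Z where "Z = (\<lambda>b x. MAX w\<in>T. exp (lin b w + D w x))"
  define bp where "bp = (\<lambda>y j. b j + 2 * c * h j y)"
  define bm where "bm = (\<lambda>y j. b j - 2 * c * h j y)"
  have [measurable]: "u w \<in> borel_measurable M" for w
    unfolding u_def lin_def by measurable
  have Dm[measurable]: "D w \<in> borel_measurable (PiM I (\<lambda>_. M))" "D w \<in> borel_measurable (PiM (insert i I) (\<lambda>_. M))"
    if [measurable]: "w \<in> T" for w
    unfolding D_def by measurable
  have Zm[measurable]: "Z b \<in> borel_measurable (PiM I (\<lambda>_. M))" for b
    unfolding Z_def using T by measurable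
  have Dupd: "D w (x(i := y)) = D w x" for w x y
    unfolding D_def by (intro sum.cong) auto
  have Z0: "0 \<le> Z b x" for b x
    unfolding Z_def using T by (meson Max_ge all_not_in_conv exp_ge_zero finite_imageI image_eqI order_trans)
  have shift: "lin b w + D w x + 2 * u w y = lin (bp y) w + D w x"
    "lin b w + D w x - 2 * u w y = lin (bm y) w + D w x" for w x y
    unfolding u_def lin_def bp_def bm_def
    by (simp_all add: algebra_simps sum.distrib sum_subtractf sum_distrib_left)
  have IH: "(\<integral>\<^sup>+x. ennreal (Z b x) \<partial>PiM I (\<lambda>_. M)) \<le> ennreal ((\<Sum>j\<in>J. exp (b j)) * exp (2 * c\<^sup>2) ^ card I)" for b
    using insert.IH[of b] by (simp add: Z_def D_def lin_def)
  let ?F = "\<lambda>x. ennreal (MAX w\<in>T. exp (lin b w + (\<Sum>i\<in>insert i I. expectation (p w) - p w (x i))))"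
  let ?G = "\<lambda>x. ennreal (((MAX w\<in>T. exp (lin b w + D w x + 2 * u w (x i)))
      + (MAX w\<in>T. exp (lin b w + D w x - 2 * u w (x i)))) / 2)"
  \<comment> \<open>The new coordinate becomes the inner integral, so that the symmetrization step
    acts on it with the other points frozen in the offset \<open>lin b w + D w x\<close>.\<close>
  have "(\<integral>\<^sup>+x. ?F x \<partial>PiM (insert i I) (\<lambda>_. M))
      = (\<integral>\<^sup>+x. \<integral>\<^sup>+y. ?F (x(i := y)) \<partial>M \<partial>PiM I (\<lambda>_. M))"
    using T by (intro P.product_nn_integral_insert) measurable
  also have "\<dots> = (\<integral>\<^sup>+x. \<integral>\<^sup>+y. ennreal (MAX w\<in>T. exp (lin b w + D w x + (expectation (p w) - p w y))) \<partial>M \<partial>PiM I (\<lambda>_. M))"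
  proof -
    have "(\<Sum>k\<in>I. expectation (p w) - p w ((x(i := y)) k)) = D w x" for w x y
      unfolding D_def by (intro sum.cong) auto
    then show ?thesis
      by (simp add: add_ac)
  qed
  also have "\<dots> \<le> (\<integral>\<^sup>+x. \<integral>\<^sup>+y. ?G (x(i := y)) \<partial>M \<partial>PiM I (\<lambda>_. M))"
  proof (rule nn_integral_mono)
    fix x
    have lin_le: "\<bar>lin (\<lambda>j. h j y) w\<bar> \<le> 1" if "w \<in> T" "y \<in> space M" for w y
    proof -
      have "\<bar>lin (\<lambda>j. h j y) w\<bar> \<le> (\<Sum>j\<in>J. \<bar>w j * h j y\<bar>)"
        unfolding lin_def by (rule sum_abs)
      also have "\<dots> \<le> (\<Sum>j\<in>J. w j)"
        using w(1)[OF that(1)] h[OF _ that(2)]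
        by (intro sum_mono) (simp add: abs_mult mult_left_le)
      finally show ?thesis
        using w(2)[OF that(1)] by simp
    qed
    have "(\<integral>\<^sup>+y. ennreal (MAX w\<in>T. exp (lin b w + D w x + (expectation (p w) - p w y))) \<partial>M)
      \<le> (\<integral>\<^sup>+y. ennreal (((MAX w\<in>T. exp (lin b w + D w x + 2 * u w y))
         + (MAX w\<in>T. exp (lin b w + D w x - 2 * u w y))) / 2) \<partial>M)"
    proof (rule symmetrization_step[OF T, where B = c])
      fix w y assume wy: "w \<in> T" "y \<in> space M"
      show "\<bar>u w y\<bar> \<le> c"
        using lin_le[OF wy] c by (simp add: u_def abs_mult mult_left_le)
      show "\<bar>p w y\<bar> \<le> \<bar>u w y\<bar>"
        using p(1)[OF wy] c by (simp add: u_def lin_def abs_mult)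
      fix v assume v: "v \<in> T"
      show "\<bar>p w y - p v y\<bar> \<le> \<bar>u w y - u v y\<bar>"
        using p(2)[OF wy(1) v wy(2)] c by (simp add: u_def lin_def abs_mult flip: right_diff_distrib)
    qed measurable
    then show "(\<integral>\<^sup>+y. ennreal (MAX w\<in>T. exp (lin b w + D w x + (expectation (p w) - p w y))) \<partial>M)
      \<le> (\<integral>\<^sup>+y. ?G (x(i := y)) \<partial>M)"
      by (simp add: Dupd)
  qed
  also have "\<dots> = integral\<^sup>N (PiM (insert i I) (\<lambda>_. M)) ?G"
    using T by (intro P.product_nn_integral_insert[symmetric]) measurable
  \<comment> \<open>The order of integration is now reversed: with \<open>y\<close> fixed outside,
    each sign leaves an integral covered by the induction hypothesis, with \<open>b\<close> replaced
    by \<open>bp y\<close> or \<open>bm y\<close>.\<close>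
  also have "\<dots> = (\<integral>\<^sup>+y. \<integral>\<^sup>+x. ?G (x(i := y)) \<partial>PiM I (\<lambda>_. M) \<partial>M)"
    using T by (intro P.product_nn_integral_insert_rev) measurable
  also have "\<dots> \<le> (\<integral>\<^sup>+y. ennreal ((\<Sum>j\<in>J. exp (b j)) * exp (2 * c\<^sup>2) ^ card (insert i I)) \<partial>M)"
  proof (rule nn_integral_mono)
    fix y assume y: "y \<in> space M"
    have "(\<integral>\<^sup>+x. ?G (x(i := y)) \<partial>PiM I (\<lambda>_. M)) = (\<integral>\<^sup>+x. ennreal ((Z (bp y) x + Z (bm y) x) / 2) \<partial>PiM I (\<lambda>_. M))"
      by (simp add: Dupd shift Z_def)
    also have "\<dots> = (\<integral>\<^sup>+x. ennreal (1 / 2) * (ennreal (Z (bp y) x) + ennreal (Z (bm y) x)) \<partial>PiM I (\<lambda>_. M))"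
      by (intro nn_integral_cong, subst ennreal_plus[symmetric], (rule Z0)+, subst ennreal_mult'[symmetric]) simp_all
    also have "\<dots> = ennreal (1 / 2) *
        ((\<integral>\<^sup>+x. ennreal (Z (bp y) x) \<partial>PiM I (\<lambda>_. M)) + (\<integral>\<^sup>+x. ennreal (Z (bm y) x) \<partial>PiM I (\<lambda>_. M)))"
      by (simp add: nn_integral_cmult nn_integral_add)
    also have "\<dots> \<le> ennreal (1 / 2) *
        (ennreal ((\<Sum>j\<in>J. exp (bp y j)) * exp (2 * c\<^sup>2) ^ card I) + ennreal ((\<Sum>j\<in>J. exp (bm y j)) * exp (2 * c\<^sup>2) ^ card I))"
      by (intro mult_left_mono add_mono IH) auto
    also have "\<dots> = ennreal (1 / 2 * ((\<Sum>j\<in>J. exp (bp y j)) * exp (2 * c\<^sup>2) ^ card I + (\<Sum>j\<in>J. exp (bm y j)) * exp (2 * c\<^sup>2) ^ card I))"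
      by (subst ennreal_plus[symmetric]; (subst ennreal_mult'[symmetric])?; simp add: sum_nonneg)
    also have "1 / 2 * ((\<Sum>j\<in>J. exp (bp y j)) * exp (2 * c\<^sup>2) ^ card I + (\<Sum>j\<in>J. exp (bm y j)) * exp (2 * c\<^sup>2) ^ card I)
        = (\<Sum>j\<in>J. exp (b j) * cosh (2 * c * h j y)) * exp (2 * c\<^sup>2) ^ card I"
    \<comment> \<open>Averaging over the two signs turns the term of vertex \<open>j\<close> into
      \<open>exp (b j)\<close> times a \<open>cosh\<close>.\<close>
    proof -
      have "(exp (bp y j) + exp (bm y j)) / 2 = exp (b j) * cosh (2 * c * h j y)" for j
        by (simp add: bp_def bm_def cosh_def exp_add exp_diff exp_minus field_simps)
      then have "(\<Sum>j\<in>J. exp (b j) * cosh (2 * c * h j y)) = (\<Sum>j\<in>J. (exp (bp y j) + exp (bm y j)) / 2)"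
        by simp
      also have "\<dots> = ((\<Sum>j\<in>J. exp (bp y j)) + (\<Sum>j\<in>J. exp (bm y j))) / 2"
        by (simp add: sum.distrib flip: sum_divide_distrib)
      finally show ?thesis
        by (simp add: algebra_simps add_divide_distrib)
    qed
    also have "ennreal \<dots> \<le> ennreal ((\<Sum>j\<in>J. exp (b j) * exp (2 * c\<^sup>2)) * exp (2 * c\<^sup>2) ^ card I)"
    proof (intro ennreal_leI mult_right_mono sum_mono mult_left_mono)
      fix j assume j: "j \<in> J"
      have "(h j y)\<^sup>2 \<le> 1"
        using h[OF j y] by (simp add: abs_square_le_1)
      then have "(2 * c * h j y)\<^sup>2 / 2 \<le> 2 * c\<^sup>2"
        by (simp add: power_mult_distrib mult_left_le)
      then show "cosh (2 * c * h j y) \<le> exp (2 * c\<^sup>2)"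
        using cosh_le_exp_square_half[of "2 * c * h j y"] by (meson exp_le_cancel_iff order_trans)
    qed auto
    also have "\<dots> = ennreal ((\<Sum>j\<in>J. exp (b j)) * exp (2 * c\<^sup>2) ^ card (insert i I))"
      by (simp add: sum_distrib_right mult.assoc)
    finally show "(\<integral>\<^sup>+x. ?G (x(i := y)) \<partial>PiM I (\<lambda>_. M))
      \<le> ennreal ((\<Sum>j\<in>J. exp (b j)) * exp (2 * c\<^sup>2) ^ card (insert i I))" .
  qed
  also have "\<dots> = ennreal ((\<Sum>j\<in>J. exp (b j)) * exp (2 * c\<^sup>2) ^ card (insert i I))"
    by (simp add: emeasure_space_1)
  finally show ?case
    by (simp only: lin_def)
qed

text \<open>Markov's inequality for the exponential of the maximal deviation, with the Chernoff
  parameter already contained in \<open>p\<close>, \<open>c\<close> and \<open>r\<close>. Starting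
  the moment bound from the zero linear term makes the vertex sum equal to \<open>card J\<close>.
  The bound is independent of the size of \<open>T\<close>, which allows arbitrarily fine
  nets.\<close>

lemma (in prob_space) emeasure_PiM_deviation_le:
  fixes p :: "('j \<Rightarrow> real) \<Rightarrow> 'a \<Rightarrow> real" and h :: "'j \<Rightarrow> 'a \<Rightarrow> real"
  assumes T: "finite T" and J: "finite J"
    and w: "\<And>w j. w \<in> T \<Longrightarrow> j \<in> J \<Longrightarrow> 0 \<le> w j" "\<And>w. w \<in> T \<Longrightarrow> (\<Sum>j\<in>J. w j) = 1"
    and pm[measurable]: "\<And>w. w \<in> T \<Longrightarrow> p w \<in> borel_measurable M"
    and hm: "\<And>j. j \<in> J \<Longrightarrow> h j \<in> borel_measurable M"
    and h: "\<And>j x. j \<in> J \<Longrightarrow> x \<in> space M \<Longrightarrow> \<bar>h j x\<bar> \<le> 1"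
    and c: "0 \<le> c"
    and p: "\<And>w x. w \<in> T \<Longrightarrow> x \<in> space M \<Longrightarrow> \<bar>p w x\<bar> \<le> c * \<bar>\<Sum>j\<in>J. w j * h j x\<bar>"
      "\<And>w v x. w \<in> T \<Longrightarrow> v \<in> T \<Longrightarrow> x \<in> space M \<Longrightarrow>
         \<bar>p w x - p v x\<bar> \<le> c * \<bar>(\<Sum>j\<in>J. w j * h j x) - (\<Sum>j\<in>J. v j * h j x)\<bar>"
    and I: "finite (I :: 'i set)"
  shows "emeasure (\<Pi>\<^sub>M i\<in>I. M) {x \<in> space (\<Pi>\<^sub>M i\<in>I. M). \<exists>w\<in>T. r \<le> (\<Sum>i\<in>I. expectation (p w) - p w (x i))}
     \<le> ennreal (card J * exp (2 * c\<^sup>2) ^ card I * exp (- r))"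
\<comment> \<open>The maximum over an empty set has no meaning, so this case is split off; the event
  is then empty.\<close>
proof (cases "T = {}")
  case False
  let ?P = "\<Pi>\<^sub>M i\<in>I. M"
  let ?D = "\<lambda>w x. \<Sum>i\<in>I. expectation (p w) - p w (x i)"
  define Z where "Z = (\<lambda>x. ennreal (MAX w\<in>T. exp (?D w x)))"
  have Zm[measurable]: "Z \<in> borel_measurable ?P"
    unfolding Z_def using T by measurable
  have "(\<integral>\<^sup>+x. Z x * indicator (space ?P) x \<partial>?P) = (\<integral>\<^sup>+x. Z x \<partial>?P)"
    by (intro nn_integral_cong) simp
  also have "(\<integral>\<^sup>+x. Z x \<partial>?P) = (\<integral>\<^sup>+x. ennreal (MAX w\<in>T. exp ((\<Sum>j\<in>J. w j * 0) + ?D w x)) \<partial>?P)"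
    by (simp add: Z_def)
  also have "\<dots> \<le> ennreal ((\<Sum>j\<in>J. exp 0) * exp (2 * c\<^sup>2) ^ card I)"
    by (rule nn_integral_PiM_Max_exp_le[where p = p and h = h]) (use assms False in auto)
  also have "(\<Sum>j\<in>J. exp 0 :: real) = card J"
    by simp
  finally have integral: "ennreal (exp (- r)) * (\<integral>\<^sup>+x. Z x * indicator (space ?P) x \<partial>?P)
      \<le> ennreal (exp (- r)) * ennreal (card J * exp (2 * c\<^sup>2) ^ card I)"
    by (rule mult_left_mono) simp
  have "{x \<in> space ?P. \<exists>w\<in>T. r \<le> ?D w x} \<subseteq> {x \<in> space ?P. 1 \<le> ennreal (exp (- r)) * Z x}"
  proof safe
    fix x w assume "w \<in> T" and r: "r \<le> ?D w x"
    then have "exp r \<le> (MAX w\<in>T. exp (?D w x))"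
      using T by (subst Max_ge_iff) auto
    then have "1 \<le> exp (- r) * (MAX w\<in>T. exp (?D w x))"
      by (simp add: exp_minus field_simps)
    then show "1 \<le> ennreal (exp (- r)) * Z x"
      by (simp add: Z_def flip: ennreal_mult')
  qed
  then have "emeasure ?P {x \<in> space ?P. \<exists>w\<in>T. r \<le> ?D w x} \<le> emeasure ?P {x \<in> space ?P. 1 \<le> ennreal (exp (- r)) * Z x}"
    by (intro emeasure_mono) measurable
  also have "\<dots> \<le> ennreal (exp (- r)) * (\<integral>\<^sup>+x. Z x * indicator (space ?P) x \<partial>?P)"
    by (intro nn_integral_Markov_inequality) auto
  also note integral
  also have "ennreal (exp (- r)) * ennreal (card J * exp (2 * c\<^sup>2) ^ card I)
      = ennreal (card J * exp (2 * c\<^sup>2) ^ card I * exp (- r))"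
    by (simp add: mult_ac flip: ennreal_mult)
  finally show ?thesis .
qed simp

section \<open>Events quantified over a compact set\<close>

text \<open>The quantifier is replaced by one over a countable dense subset, at the cost of a slack
  \<open>1 / real (Suc k)\<close> for every \<open>k\<close>. Continuity moves a witness into the
  dense subset within the slack; conversely, a minimiser on \<open>K\<close>, which exists by
  compactness, has a value below \<open>a\<close> plus every slack.\<close>

lemma measurable_exists_le_compact:
  fixes f :: "'a :: {metric_space, second_countable_topology} \<Rightarrow> 'w \<Rightarrow> real"
  assumes K: "compact K"
    and cont: "\<And>\<omega>. \<omega> \<in> space M \<Longrightarrow> continuous_on K (\<lambda>w. f w \<omega>)"
    and meas: "\<And>w. w \<in> K \<Longrightarrow> f w \<in> borel_measurable M"
  shows "{\<omega> \<in> space M. \<exists>w\<in>K. f w \<omega> \<le> a} \<in> sets M"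
proof -
  obtain D where D: "countable D" "D \<subseteq> K" "K \<subseteq> closure D"
    by (rule separable)
  have "(\<exists>w\<in>K. f w \<omega> \<le> a) \<longleftrightarrow> (\<forall>k. \<exists>d\<in>D. f d \<omega> < a + 1 / real (Suc k))" if \<omega>: "\<omega> \<in> space M" for \<omega>
  proof
    assume "\<exists>w\<in>K. f w \<omega> \<le> a"
    then obtain w where w: "w \<in> K" "f w \<omega> \<le> a" by blast
    show "\<forall>k. \<exists>d\<in>D. f d \<omega> < a + 1 / real (Suc k)"
    proof
      fix k
      obtain U where U: "open U" "U \<inter> K = (\<lambda>w. f w \<omega>) -` {..<a + 1 / real (Suc k)} \<inter> K"
        using cont[OF \<omega>] open_lessThan unfolding continuous_on_open_invariant by blast
      have "w \<in> (\<lambda>w. f w \<omega>) -` {..<a + 1 / real (Suc k)} \<inter> K"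
        using w by (auto intro: le_less_trans)
      then have "w \<in> U" using U by blast
      moreover have "w \<in> closure D" using w D by blast
      ultimately obtain d where d: "d \<in> D" "d \<in> U"
        using U(1) open_Int_closure_eq_empty[of U D] by blast
      then have "d \<in> (\<lambda>w. f w \<omega>) -` {..<a + 1 / real (Suc k)} \<inter> K"
        using U D by blast
      then show "\<exists>d\<in>D. f d \<omega> < a + 1 / real (Suc k)"
        using d by blast
    qed
  next
    assume R: "\<forall>k. \<exists>d\<in>D. f d \<omega> < a + 1 / real (Suc k)"
    then have "K \<noteq> {}" using D by blast
    then obtain w where w: "w \<in> K" "\<And>v. v \<in> K \<Longrightarrow> f w \<omega> \<le> f v \<omega>"
      using continuous_attains_inf[OF K _ cont[OF \<omega>]] by blast
    have "f w \<omega> \<le> a"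
    proof (rule ccontr)
      assume "\<not> ?thesis"
      then obtain k where "inverse (real (Suc k)) < f w \<omega> - a"
        using reals_Archimedean[of "f w \<omega> - a"] by auto
      moreover obtain d where "d \<in> D" "f d \<omega> < a + 1 / real (Suc k)"
        using R by blast
      ultimately show False
        using w(2)[of d] D(2) by (auto simp: inverse_eq_divide)
    qed
    then show "\<exists>w\<in>K. f w \<omega> \<le> a"
      using w by blast
  qed
  then have "{\<omega> \<in> space M. \<exists>w\<in>K. f w \<omega> \<le> a}
      = {\<omega> \<in> space M. \<forall>k. \<exists>d\<in>D. f d \<omega> < a + 1 / real (Suc k)}"
    by blast
  also have "\<dots> \<in> sets M"
  proof (intro sets.sets_Collect_countable_All sets.sets_Collect_countable_Ex' D(1))
    fix k d assume "d \<in> D"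
    then have [measurable]: "f d \<in> borel_measurable M"
      using meas D by blast
    show "{\<omega> \<in> space M. f d \<omega> < a + 1 / real (Suc k)} \<in> sets M"
      by measurable
  qed
  finally show ?thesis .
qed

section \<open>The simplex as a compact set with finite nets\<close>

text \<open>
  Members of \<^const>\<open>simplex_weights\<close> are unconstrained outside \<open>{1..m}\<close>; fixing these values to zero
  yields a compact set in the product topology without changing the convex combinations.
\<close>

definition padded_simplex :: "nat \<Rightarrow> (nat \<Rightarrow> real) set" where
  "padded_simplex m = {w \<in> simplex_weights m. \<forall>j. j \<notin> {1..m} \<longrightarrow> w j = 0}"

lemma padded_simplex_subset: "padded_simplex m \<subseteq> simplex_weights m"
  by (auto simp: padded_simplex_def)

lemma H_conv_eq_padded: "H_conv m h = conv_comb m h ` padded_simplex m"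
proof -
  have "conv_comb m h w \<in> conv_comb m h ` padded_simplex m" if "w \<in> simplex_weights m" for w
  proof (rule image_eqI)
    show "conv_comb m h w = conv_comb m h (\<lambda>j. if j \<in> {1..m} then w j else 0)"
      by (simp add: conv_comb_def fun_eq_iff)
    show "(\<lambda>j. if j \<in> {1..m} then w j else 0) \<in> padded_simplex m"
      using that by (auto simp: padded_simplex_def simplex_weights_def)
  qed
  then show ?thesis
    using padded_simplex_subset by (auto simp: H_conv_def)
qed

text \<open>The box \<open>?B\<close> is compact by Tychonoff's theorem, and the sum constraint is
  closed because it involves finitely many coordinates.\<close>

lemma compact_padded_simplex: "compact (padded_simplex m)"
proof -
  let ?B = "PiE UNIV (\<lambda>j. if j \<in> {1..m} then {0..1} else {0}) :: (nat \<Rightarrow> real) set"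
  have "compactin (product_topology (\<lambda>_. euclidean) UNIV) ?B"
    by (subst compactin_PiE) auto
  then have "compact ?B"
    by (simp add: euclidean_product_topology)
  moreover have "closed {w :: nat \<Rightarrow> real. (\<Sum>j=1..m. w j) = 1}"
    by (intro closed_Collect_eq continuous_intros) auto
  moreover have "padded_simplex m = ?B \<inter> {w. (\<Sum>j=1..m. w j) = 1}"
  proof -
    have "w j \<le> 1" if "w \<in> simplex_weights m" "j \<in> {1..m}" for w j
    proof -
      have "w j \<le> (\<Sum>j=1..m. w j)"
        using that by (intro member_le_sum) (auto simp: simplex_weights_def)
      then show ?thesis
        using that by (simp add: simplex_weights_def)
    qed
    then show ?thesis
      by (auto simp: padded_simplex_def simplex_weights_def PiE_iff split: if_splits)
  qed
  ultimately show ?thesis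
    by (simp add: compact_Int_closed)
qed

text \<open>The l1 distance on the first \<open>m\<close> coordinates is continuous in the product
  topology, so its balls are open and a finite subcover supplies the net.\<close>

lemma padded_simplex_net:
  fixes \<eta> :: real
  assumes "0 < \<eta>"
  obtains T where "finite T" "T \<subseteq> padded_simplex m"
    "\<And>w. w \<in> padded_simplex m \<Longrightarrow> \<exists>v\<in>T. (\<Sum>j=1..m. \<bar>w j - v j\<bar>) < \<eta>"
proof -
  let ?U = "\<lambda>v. {w :: nat \<Rightarrow> real. (\<Sum>j=1..m. \<bar>w j - v j\<bar>) < \<eta>}"
  have "open (?U v)" for v
    by (intro open_Collect_less continuous_intros) auto
  moreover have "padded_simplex m \<subseteq> (\<Union>v\<in>padded_simplex m. ?U v)"
    using assms by auto
  ultimately obtain T where "T \<subseteq> padded_simplex m" "finite T" "padded_simplex m \<subseteq> (\<Union>v\<in>T. ?U v)"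
    using compactE_image[OF compact_padded_simplex, of "padded_simplex m" ?U m] by blast
  then show thesis
    by (intro that[of T]) auto
qed

section \<open>Regularity of convex combinations under a Lipschitz surrogate\<close>

lemma abs_conv_comb_le:
  assumes "w \<in> simplex_weights m" "\<And>j. j \<in> {1..m} \<Longrightarrow> \<bar>h j x\<bar> \<le> 1"
  shows "\<bar>conv_comb m h w x\<bar> \<le> 1"
proof -
  have "\<bar>conv_comb m h w x\<bar> \<le> (\<Sum>j=1..m. \<bar>w j * h j x\<bar>)"
    unfolding conv_comb_def by (rule sum_abs)
  also have "\<dots> \<le> (\<Sum>j=1..m. w j)"
    using assms by (intro sum_mono) (simp add: abs_mult mult_left_le simplex_weights_def)
  finally show ?thesis
    using assms by (simp add: simplex_weights_def)
qed

lemma abs_conv_comb_diff_le: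
  assumes "\<And>j. j \<in> {1..m} \<Longrightarrow> \<bar>h j x\<bar> \<le> 1"
  shows "\<bar>conv_comb m h w x - conv_comb m h v x\<bar> \<le> (\<Sum>j=1..m. \<bar>w j - v j\<bar>)"
proof -
  have "\<bar>conv_comb m h w x - conv_comb m h v x\<bar> = \<bar>\<Sum>j=1..m. (w j - v j) * h j x\<bar>"
    by (simp add: conv_comb_def sum_subtractf algebra_simps)
  also have "\<dots> \<le> (\<Sum>j=1..m. \<bar>(w j - v j) * h j x\<bar>)"
    by (rule sum_abs)
  also have "\<dots> \<le> (\<Sum>j=1..m. \<bar>w j - v j\<bar>)"
    using assms by (intro sum_mono) (simp add: abs_mult mult_left_le)
  finally show ?thesis .
qed

lemma classifier_conv_comb:
  assumes "\<forall>j\<in>{1..m}. classifier \<X> (h j)" "w \<in> simplex_weights m"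
  shows "classifier \<X> (conv_comb m h w)"
proof -
  have "h j \<in> borel_measurable (feature_space \<X>)" if "j \<in> {1..m}" for j
    using assms that by (auto simp: classifier_def)
  then have "conv_comb m h w \<in> borel_measurable (feature_space \<X>)"
    unfolding conv_comb_def by measurable
  moreover have "conv_comb m h w x \<in> {-1..1}" if "x \<in> \<X>" for x
    using abs_conv_comb_le[OF assms(2), of h x] assms(1) that by (force simp: classifier_def Pi_iff abs_le_iff)
  ultimately show ?thesis
    by (auto simp: classifier_def)
qed

text \<open>Outside \<open>{-1..1}\<close> the function \<open>\<phi>\<close> is arbitrary and
  possibly not measurable, so the composition is routed through the restricted Borel space.\<close>

lemma borel_measurable_lipschitz_comp:
  fixes \<phi> u :: "_ \<Rightarrow> real"
  assumes "L-lipschitz_on {-1..1} \<phi>" "u \<in> borel_measurable M" "\<And>x. x \<in> space M \<Longrightarrow> \<bar>u x\<bar> \<le> 1"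
  shows "(\<lambda>x. \<phi> (u x)) \<in> borel_measurable M"
proof (rule measurable_compose[of u M "restrict_space borel {-1..1}"])
  show "u \<in> measurable M (restrict_space borel {-1..1})"
    using assms(2,3) by (intro measurable_restrict_space2) (auto simp: abs_le_iff minus_le_iff)
  show "\<phi> \<in> borel_measurable (restrict_space borel {-1..1})"
    using assms(1) by (intro borel_measurable_continuous_on_restrict lipschitz_on_continuous_on)
qed

lemma lipschitz_on_unit_diff_le:
  fixes \<phi> :: "real \<Rightarrow> real"
  assumes "L-lipschitz_on {-1..1} \<phi>" "\<bar>x\<bar> \<le> 1" "\<bar>y\<bar> \<le> 1"
  shows "\<bar>\<phi> x - \<phi> y\<bar> \<le> L * \<bar>x - y\<bar>"
proof -
  have "x \<in> {-1..1}" "y \<in> {-1..1}"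
    using assms(2,3) by auto
  then show ?thesis
    using lipschitz_onD[OF assms(1)] by (simp add: dist_real_def)
qed

lemma (in prob_space) integrable_lipschitz_comp:
  fixes \<phi> :: "real \<Rightarrow> real"
  assumes \<phi>: "L-lipschitz_on {-1..1} \<phi>"
    and u: "u \<in> borel_measurable M" "\<And>x. x \<in> space M \<Longrightarrow> \<bar>u x\<bar> \<le> 1"
  shows "integrable M (\<lambda>x. \<phi> (u x))"
proof (rule integrable_const_bound[where B = "\<bar>\<phi> 0\<bar> + L"])
  have "\<bar>\<phi> (u x)\<bar> \<le> \<bar>\<phi> 0\<bar> + L" if "x \<in> space M" for x
  proof -
    have "\<bar>\<phi> (u x) - \<phi> 0\<bar> \<le> L * \<bar>u x\<bar>"
      using lipschitz_on_unit_diff_le[OF \<phi> u(2)[OF that], of 0] by simp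
    also have "\<dots> \<le> L"
      using u(2)[OF that] lipschitz_on_nonneg[OF \<phi>] by (simp add: mult_left_le)
    finally show ?thesis by linarith
  qed
  then show "AE x in M. norm (\<phi> (u x)) \<le> \<bar>\<phi> 0\<bar> + L"
    by simp
qed (rule borel_measurable_lipschitz_comp[OF \<phi> u])

section \<open>Deviation on a finite set of weights, and dependence of the errors on the
  weights\<close>

text \<open>The tail bound is applied to the surrogate scaled by \<open>s\<close>, which is
  \<open>s * L\<close>-Lipschitz in the value of the convex combination; hence \<open>c\<close> is
  \<open>s * L\<close>. The threshold uses half of \<open>kappa\<close>, which leaves the other half
  for the distance to the net.\<close>

lemma (in prob_space) conv_comb_deviation:
  fixes h :: "nat \<Rightarrow> 'a \<Rightarrow> real" and \<phi> :: "real \<Rightarrow> real"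
  assumes \<phi>: "L-lipschitz_on {-1..1} \<phi>" and L: "0 < L" and m: "1 \<le> m" and n: "1 \<le> n"
    and \<delta>: "0 < \<delta>" "\<delta> < 1"
    and T: "finite T" "T \<subseteq> simplex_weights m"
    and hm: "\<And>j. j \<in> {1..m} \<Longrightarrow> h j \<in> borel_measurable M"
    and h: "\<And>j x. j \<in> {1..m} \<Longrightarrow> x \<in> space M \<Longrightarrow> \<bar>h j x\<bar> \<le> 1"
  shows "emeasure (\<Pi>\<^sub>M i\<in>{1..n}. M) {x \<in> space (\<Pi>\<^sub>M i\<in>{1..n}. M). \<exists>w\<in>T.
      real n * (kappa L m \<delta> / sqrt (real n) / 2)
        \<le> (\<Sum>i=1..n. expectation (\<lambda>y. \<phi> (conv_comb m h w y)) - \<phi> (conv_comb m h w (x i)))}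
     \<le> ennreal \<delta>"
proof -
  define l where "l = ln (2 * real m / \<delta>)"
  define t where "t = kappa L m \<delta> / sqrt (real n) / 2"
  \<comment> \<open>\<open>s\<close> minimises the Chernoff exponent \<open>n (2 s\<^sup>2 L\<^sup>2 - s t)\<close>\<close>
  define s where "s = t / (4 * L\<^sup>2)"
  let ?u = "conv_comb m h"
  \<comment> \<open>Subtracting \<open>\<phi> 0\<close> makes \<open>p\<close> vanish wherever the
    convex combination does, as the contraction requires; the constant cancels in
    \<open>expectation (p w) - p w x\<close>.\<close>
  define p where "p = (\<lambda>w x. s * (\<phi> (?u w x) - \<phi> 0))"
  have "1 < 2 * real m / \<delta>"
    using m \<delta> by (simp add: field_simps)
  then have l: "0 < l"
    by (simp add: l_def)
  \<comment> \<open>Half of \<open>kappa L m \<delta>\<close> is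
    \<open>2 * sqrt 2 * L * sqrt l\<close>, whose square is
    \<open>8 * L\<^sup>2 * l\<close>.\<close>
  have t: "0 < t" "real n * t\<^sup>2 = 8 * L\<^sup>2 * l"
    using L n l by (simp_all add: t_def kappa_def power_mult_distrib power_divide flip: l_def)
  have s: "0 < s"
    using t L by (simp add: s_def)
  have um: "?u w \<in> borel_measurable M" for w
    unfolding conv_comb_def using hm by measurable
  have u1: "\<bar>?u w x\<bar> \<le> 1" if "w \<in> T" "x \<in> space M" for w x
    using that T h by (intro abs_conv_comb_le) auto
  have \<phi>m: "(\<lambda>x. \<phi> (?u w x)) \<in> borel_measurable M" if "w \<in> T" for w
    using \<phi> um u1[OF that] by (rule borel_measurable_lipschitz_comp)
  have \<phi>i: "integrable M (\<lambda>x. \<phi> (?u w x))" if "w \<in> T" for w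
    using \<phi> um u1[OF that] by (rule integrable_lipschitz_comp)
  have Ep: "expectation (p w) - p w x = s * (expectation (\<lambda>y. \<phi> (?u w y)) - \<phi> (?u w x))" if "w \<in> T" for w x
    using \<phi>i[OF that] by (simp add: p_def prob_space algebra_simps)
  have "emeasure (\<Pi>\<^sub>M i\<in>{1..n}. M) {x \<in> space (\<Pi>\<^sub>M i\<in>{1..n}. M). \<exists>w\<in>T.
        s * (real n * t) \<le> (\<Sum>i=1..n. expectation (p w) - p w (x i))}
      \<le> ennreal (card {1..m} * exp (2 * (s * L)\<^sup>2) ^ card {1..n} * exp (- (s * (real n * t))))"
  proof (rule emeasure_PiM_deviation_le[where h = h])
    fix w assume w: "w \<in> T"
    show "(\<Sum>j\<in>{1..m}. w j) = 1" "\<And>j. j \<in> {1..m} \<Longrightarrow> 0 \<le> w j"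
      using w T by (auto simp: simplex_weights_def)
    show "p w \<in> borel_measurable M"
      unfolding p_def using \<phi>m[OF w] by measurable
    fix x assume x: "x \<in> space M"
    show "\<bar>p w x\<bar> \<le> s * L * \<bar>\<Sum>j\<in>{1..m}. w j * h j x\<bar>"
      using lipschitz_on_unit_diff_le[OF \<phi> u1[OF w x], of 0] s
      by (simp add: p_def conv_comb_def abs_mult mult.assoc)
    fix v assume v: "v \<in> T"
    have "\<bar>p w x - p v x\<bar> = s * \<bar>\<phi> (?u w x) - \<phi> (?u v x)\<bar>"
      using s by (simp add: p_def abs_mult flip: right_diff_distrib)
    then show "\<bar>p w x - p v x\<bar> \<le> s * L * \<bar>(\<Sum>j\<in>{1..m}. w j * h j x) - (\<Sum>j\<in>{1..m}. v j * h j x)\<bar>"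
      using lipschitz_on_unit_diff_le[OF \<phi> u1[OF w x] u1[OF v x]] s
      by (simp add: conv_comb_def mult.assoc)
  qed (use T hm h s L in auto)
  also have "real (card {1..m}) * exp (2 * (s * L)\<^sup>2) ^ card {1..n} * exp (- (s * (real n * t)))
      = real m * exp (real n * (2 * (s * L)\<^sup>2) - s * (real n * t))"
    by (simp add: exp_of_nat_mult exp_diff exp_minus field_simps)
  also have "real n * (2 * (s * L)\<^sup>2) - s * (real n * t) = - (real n * t\<^sup>2) / (8 * L\<^sup>2)"
    using L by (simp add: s_def power_mult_distrib power_divide field_simps power2_eq_square power4_eq_xxxx)
  also have "\<dots> = - l"
    using L by (simp add: t)
  \<comment> \<open>By the choice of \<open>l\<close>, \<open>exp (- l)\<close> is
    \<open>\<delta> / (2 * real m)\<close>, which cancels the number of vertices.\<close>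
  also have "real m * exp (- l) = \<delta> / 2"
    using m \<delta> by (simp add: l_def exp_minus)
  also have "ennreal (\<delta> / 2) \<le> ennreal \<delta>"
    using \<delta> by (intro ennreal_leI) simp
  also have "{x \<in> space (\<Pi>\<^sub>M i\<in>{1..n}. M). \<exists>w\<in>T. s * (real n * t) \<le> (\<Sum>i=1..n. expectation (p w) - p w (x i))}
      = {x \<in> space (\<Pi>\<^sub>M i\<in>{1..n}. M). \<exists>w\<in>T.
          real n * t \<le> (\<Sum>i=1..n. expectation (\<lambda>y. \<phi> (?u w y)) - \<phi> (?u w (x i)))}"
    using s by (intro Collect_cong conj_cong bex_cong refl) (simp add: Ep flip: sum_distrib_left)
  finally show ?thesis
    unfolding t_def .
qed

text \<open>Together with its empirical counterpart, this carries the bound from the net to the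
  simplex and gives the continuity needed for measurability. The l1 distance arises because every
  \<open>h j\<close> is bounded by 1.\<close>

lemma (in prob_space) expectation_conv_comb_diff_le:
  fixes h :: "nat \<Rightarrow> 'a \<Rightarrow> real" and \<phi> :: "real \<Rightarrow> real"
  assumes \<phi>: "L-lipschitz_on {-1..1} \<phi>"
    and wv: "w \<in> simplex_weights m" "v \<in> simplex_weights m"
    and hm: "\<And>j. j \<in> {1..m} \<Longrightarrow> h j \<in> borel_measurable M"
    and h: "\<And>j x. j \<in> {1..m} \<Longrightarrow> x \<in> space M \<Longrightarrow> \<bar>h j x\<bar> \<le> 1"
  shows "\<bar>expectation (\<lambda>x. \<phi> (conv_comb m h w x)) - expectation (\<lambda>x. \<phi> (conv_comb m h v x))\<bar>
    \<le> L * (\<Sum>j=1..m. \<bar>w j - v j\<bar>)"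
proof -
  let ?d = "L * (\<Sum>j=1..m. \<bar>w j - v j\<bar>)"
  have int: "integrable M (\<lambda>x. \<phi> (conv_comb m h w x))" if "w \<in> simplex_weights m" for w
  proof (rule integrable_lipschitz_comp[OF \<phi>])
    show "conv_comb m h w \<in> borel_measurable M"
      unfolding conv_comb_def using hm by measurable
  qed (use that h in \<open>auto intro: abs_conv_comb_le\<close>)
  have "\<bar>expectation (\<lambda>x. \<phi> (conv_comb m h w x)) - expectation (\<lambda>x. \<phi> (conv_comb m h v x))\<bar>
      = \<bar>expectation (\<lambda>x. \<phi> (conv_comb m h w x) - \<phi> (conv_comb m h v x))\<bar>"
    using int wv by simp
  also have "\<dots> \<le> expectation (\<lambda>x. \<bar>\<phi> (conv_comb m h w x) - \<phi> (conv_comb m h v x)\<bar>)"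
    by (rule integral_abs_bound)
  also have "\<dots> \<le> expectation (\<lambda>_. ?d)"
  proof (rule integral_mono)
    fix x assume x: "x \<in> space M"
    have "\<bar>\<phi> (conv_comb m h w x) - \<phi> (conv_comb m h v x)\<bar> \<le> L * \<bar>conv_comb m h w x - conv_comb m h v x\<bar>"
      using wv h x by (intro lipschitz_on_unit_diff_le[OF \<phi>] abs_conv_comb_le) auto
    also have "\<dots> \<le> ?d"
      using h x lipschitz_on_nonneg[OF \<phi>] by (intro mult_left_mono abs_conv_comb_diff_le) auto
    finally show "\<bar>\<phi> (conv_comb m h w x) - \<phi> (conv_comb m h v x)\<bar> \<le> ?d" .
  qed (use int wv in auto)
  finally show ?thesis
    by (simp add: prob_space)
qed

lemma emp_phi_conv_comb_diff_le:
  fixes h :: "nat \<Rightarrow> 'x \<Rightarrow> real" and \<phi> :: "real \<Rightarrow> real"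
  assumes \<phi>: "L-lipschitz_on {-1..1} \<phi>" and n: "1 \<le> n"
    and wv: "w \<in> simplex_weights m" "v \<in> simplex_weights m"
    and h: "\<And>i j. i \<in> {1..n} \<Longrightarrow> j \<in> {1..m} \<Longrightarrow> \<bar>h j (s i)\<bar> \<le> 1"
  shows "\<bar>emp_phi_type1_error \<phi> n s (conv_comb m h w) - emp_phi_type1_error \<phi> n s (conv_comb m h v)\<bar>
    \<le> L * (\<Sum>j=1..m. \<bar>w j - v j\<bar>)"
proof -
  let ?d = "L * (\<Sum>j=1..m. \<bar>w j - v j\<bar>)"
  have "\<bar>\<Sum>i=1..n. \<phi> (conv_comb m h w (s i)) - \<phi> (conv_comb m h v (s i))\<bar>
      \<le> (\<Sum>i=1..n. \<bar>\<phi> (conv_comb m h w (s i)) - \<phi> (conv_comb m h v (s i))\<bar>)"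
    by (rule sum_abs)
  also have "\<dots> \<le> (\<Sum>i=1..n. ?d)"
  proof (rule sum_mono)
    fix i assume i: "i \<in> {1..n}"
    have "\<bar>\<phi> (conv_comb m h w (s i)) - \<phi> (conv_comb m h v (s i))\<bar>
        \<le> L * \<bar>conv_comb m h w (s i) - conv_comb m h v (s i)\<bar>"
      using wv h i by (intro lipschitz_on_unit_diff_le[OF \<phi>] abs_conv_comb_le) auto
    also have "\<dots> \<le> ?d"
      using h i lipschitz_on_nonneg[OF \<phi>] by (intro mult_left_mono abs_conv_comb_diff_le) auto
    finally show "\<bar>\<phi> (conv_comb m h w (s i)) - \<phi> (conv_comb m h v (s i))\<bar> \<le> ?d" .
  qed
  finally have "\<bar>\<Sum>i=1..n. \<phi> (conv_comb m h w (s i)) - \<phi> (conv_comb m h v (s i))\<bar> \<le> real n * ?d"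
    by simp
  then show ?thesis
    using n by (simp add: emp_phi_type1_error_def sum_subtractf field_simps flip: diff_divide_distrib)
qed

text \<open>The metric on \<open>nat \<Rightarrow> real\<close> is not the l1 distance, so Lipschitz
  continuity in that metric is not what is given; instead the l1 distance over \<open>J\<close>,
  continuous in the product topology, squeezes \<open>F w - F v\<close> to zero.\<close>

lemma continuous_on_l1_lipschitz:
  fixes F :: "(nat \<Rightarrow> real) \<Rightarrow> real"
  assumes "\<And>w v. w \<in> K \<Longrightarrow> v \<in> K \<Longrightarrow> \<bar>F w - F v\<bar> \<le> L * (\<Sum>j\<in>J. \<bar>w j - v j\<bar>)"
  shows "continuous_on K F"
  unfolding continuous_on_def
proof
  fix v assume v: "v \<in> K"
  have "continuous_on UNIV (\<lambda>w. L * (\<Sum>j\<in>J. \<bar>w j - v j\<bar>))"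
    by (intro continuous_intros) auto
  then have "continuous_on K (\<lambda>w. L * (\<Sum>j\<in>J. \<bar>w j - v j\<bar>))"
    by (rule continuous_on_subset) simp
  then have "((\<lambda>w. L * (\<Sum>j\<in>J. \<bar>w j - v j\<bar>)) \<longlongrightarrow> L * (\<Sum>j\<in>J. \<bar>v j - v j\<bar>)) (at v within K)"
    using v unfolding continuous_on_def by blast
  then have "((\<lambda>w. L * (\<Sum>j\<in>J. \<bar>w j - v j\<bar>)) \<longlongrightarrow> 0) (at v within K)"
    by simp
  then have "((\<lambda>w. F w - F v) \<longlongrightarrow> 0) (at v within K)"
    by (rule Lim_null_comparison[rotated]) (use assms v in \<open>auto simp: eventually_at_filter\<close>)
  then show "(F \<longlongrightarrow> F v) (at v within K)"
    by (rule LIM_zero_cancel)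
qed

text \<open>The complement asks for a weight with \<open>f w \<omega> \<le> a\<close> and
  \<open>b < g w\<close>. The strict condition is not closed, so it is exhausted by the sets
  \<open>?K k\<close>, which are compact and hence within reach of
  \<open>measurable_exists_le_compact\<close>.\<close>

lemma measurable_forall_le_imp_le_compact:
  fixes f :: "'a :: {metric_space, second_countable_topology} \<Rightarrow> 'w \<Rightarrow> real" and g :: "'a \<Rightarrow> real"
  assumes K: "compact K" and g: "continuous_on K g"
    and cont: "\<And>\<omega>. \<omega> \<in> space M \<Longrightarrow> continuous_on K (\<lambda>w. f w \<omega>)"
    and meas: "\<And>w. w \<in> K \<Longrightarrow> f w \<in> borel_measurable M"
  shows "{\<omega> \<in> space M. \<forall>w\<in>K. f w \<omega> \<le> a \<longrightarrow> g w \<le> b} \<in> sets M"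
proof -
  let ?K = "\<lambda>k. K \<inter> g -` {b + 1 / real (Suc k)..}"
  have gt: "b < g w \<longleftrightarrow> (\<exists>k. b + 1 / real (Suc k) \<le> g w)" for w
  proof
    assume "b < g w"
    then obtain k where "inverse (real (Suc k)) < g w - b"
      using reals_Archimedean[of "g w - b"] by auto
    then show "\<exists>k. b + 1 / real (Suc k) \<le> g w"
      by (intro exI[of _ k]) (simp add: inverse_eq_divide)
  next
    assume "\<exists>k. b + 1 / real (Suc k) \<le> g w"
    then obtain k where "b + 1 / real (Suc k) \<le> g w" ..
    moreover have "0 < 1 / real (Suc k)" by simp
    ultimately show "b < g w" by linarith
  qed
  have "{\<omega> \<in> space M. \<exists>w\<in>?K k. f w \<omega> \<le> a} \<in> sets M" for k
  proof (rule measurable_exists_le_compact)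
    have "closed (?K k)"
      using continuous_on_closed_vimage[OF compact_imp_closed[OF K]] g by (metis Int_commute closed_atLeast)
    then show "compact (?K k)"
      using compact_Int_closed[OF K] by (metis inf.left_idem)
    show "continuous_on (?K k) (\<lambda>w. f w \<omega>)" if "\<omega> \<in> space M" for \<omega>
      using cont[OF that] by (rule continuous_on_subset) auto
  qed (use meas in auto)
  then have "space M - (\<Union>k. {\<omega> \<in> space M. \<exists>w\<in>?K k. f w \<omega> \<le> a}) \<in> sets M"
    by blast
  also have "space M - (\<Union>k. {\<omega> \<in> space M. \<exists>w\<in>?K k. f w \<omega> \<le> a})
      = {\<omega> \<in> space M. \<forall>w\<in>K. f w \<omega> \<le> a \<longrightarrow> \<not> b < g w}"
    by (subst gt) auto
  finally show ?thesis
    by (simp add: not_less)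
qed

section \<open>The conditional law, the two type I errors and the law of the sample\<close>

lemma prob_space_P_neg:
  assumes "prob_space N" "X \<in> measurable N (feature_space \<X>)"
    and "measure N {\<omega> \<in> space N. Y \<omega> = -1} > 0"
  shows "prob_space (P_neg \<X> N X Y)"
proof -
  interpret prob_space N by fact
  have "prob_space (given_neg N Y)"
    unfolding given_neg_def using assms(3)
    by (intro prob_space_uniform_measure) (auto simp: emeasure_eq_measure)
  then show ?thesis
    unfolding P_neg_def using assms(2)
    by (intro prob_space.prob_space_distr) (simp_all add: given_neg_def)
qed

text \<open>Monotonicity and \<open>\<phi> 0 = 1\<close> give \<open>\<phi> \<ge> 1\<close> on
  \<open>{0..1}\<close>, and \<open>\<phi>\<close> is nonnegative on the rest of
  \<open>{-1..1}\<close>; so \<open>\<phi> (g x)\<close> dominates the indicator of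
  \<open>0 \<le> g x\<close>.\<close>

lemma type1_error_le_phi_type1_error:
  fixes X :: "'w \<Rightarrow> real ^ 'd"
  assumes N: "prob_space N" and X: "X \<in> measurable N (feature_space \<X>)"
    and Y: "Y \<in> measurable N (count_space {-1, 1})"
    and pos: "measure N {\<omega> \<in> space N. Y \<omega> = -1} > 0"
    and g: "classifier \<X> g" and \<phi>: "convex_surrogate \<phi>" "L-lipschitz_on {-1..1} \<phi>"
  shows "type1_error N X Y g \<le> phi_type1_error \<phi> N X Y g"
proof -
  interpret D: prob_space "P_neg \<X> N X Y"
    using N X pos by (rule prob_space_P_neg)
  have space: "space (P_neg \<X> N X Y) = \<X>"
    by (simp add: P_neg_def space_restrict_space)
  have gm: "g \<in> borel_measurable (P_neg \<X> N X Y)"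
    using g by (simp add: classifier_def P_neg_def)
  have g1: "g x \<in> {-1..1}" if "x \<in> \<X>" for x
    using g that by (auto simp: classifier_def)
  have set: "{x \<in> \<X>. 0 \<le> g x} \<in> D.events"
    using measurable_sets[OF gm, of "{0..}"] by (simp add: space vimage_def Int_def conj_commute)
  have "measure (P_neg \<X> N X Y) {x \<in> \<X>. 0 \<le> g x} = (\<integral>x. indicator {x \<in> \<X>. 0 \<le> g x} x \<partial>P_neg \<X> N X Y)"
    using set by simp
  also have "\<dots> \<le> (\<integral>x. \<phi> (g x) \<partial>P_neg \<X> N X Y)"
  proof (rule integral_mono)
    show "integrable (P_neg \<X> N X Y) (\<lambda>x. \<phi> (g x))"
      using g1 by (intro D.integrable_lipschitz_comp[OF \<phi>(2) gm]) (force simp: space abs_le_iff)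
    fix x assume "x \<in> space (P_neg \<X> N X Y)"
    then have x: "g x \<in> {-1..1}"
      using g1 space by auto
    then have "0 \<le> \<phi> (g x)"
      using \<phi>(1) by (auto simp: convex_surrogate_def)
    moreover have "1 \<le> \<phi> (g x)" if "0 \<le> g x"
      using \<phi>(1) x that mono_onD[of "{-1..1}" \<phi> 0 "g x"] by (auto simp: convex_surrogate_def)
    ultimately show "indicator {x \<in> \<X>. 0 \<le> g x} x \<le> \<phi> (g x)"
      by (auto simp: indicator_def)
  qed (use set in \<open>simp add: integrable_indicator_iff D.emeasure_eq_measure\<close>)
  finally show ?thesis
    using type1_error_eq_P_neg[OF N X Y pos g] phi_type1_error_eq_P_neg[OF N X Y pos g \<phi>(1)] by simp
qed

text \<open>Independence makes the joint law the product of the marginals, so estimates on the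
  product space transfer to the sample. The hypothesis \<open>1 \<le> n\<close> keeps the index set
  nonempty.\<close>

lemma (in prob_space) iid_sample_distr_PiM:
  assumes "iid_sample M D n S" "1 \<le> n"
  shows "distr M (\<Pi>\<^sub>M i\<in>{1..n}. D) (\<lambda>\<omega>. \<lambda>i\<in>{1..n}. S i \<omega>) = (\<Pi>\<^sub>M i\<in>{1..n}. D)"
proof -
  have "\<And>i. i \<in> {1..n} \<Longrightarrow> S i \<in> measurable M D"
    using assms(1) by (auto simp: iid_sample_def indep_vars_def2)
  then have "distr M (\<Pi>\<^sub>M i\<in>{1..n}. D) (\<lambda>\<omega>. \<lambda>i\<in>{1..n}. S i \<omega>) = (\<Pi>\<^sub>M i\<in>{1..n}. distr M D (S i))"
    using assms by (subst indep_vars_iff_distr_eq_PiM'[symmetric]) (auto simp: iid_sample_def)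
  also have "\<dots> = (\<Pi>\<^sub>M i\<in>{1..n}. D)"
    using assms(1) by (intro PiM_cong) (auto simp: iid_sample_def)
  finally show ?thesis .
qed

section \<open>From a net to all convex combinations, uniformly over data-dependent choices\<close>

theorem theorem4p1:
  fixes N :: "'w measure"
    and \<X> :: "(real ^ 'd) set"
    and X :: "'w \<Rightarrow> real ^ 'd" and Y :: "'w \<Rightarrow> real"
    and S :: "nat \<Rightarrow> 'w \<Rightarrow> real ^ 'd"
    and h :: "nat \<Rightarrow> real ^ 'd \<Rightarrow> real"
    and \<phi> :: "real \<Rightarrow> real"
    and m n :: nat
    and \<delta> \<alpha> L :: real
  assumes "prob_space N"
    and "X \<in> measurable N (feature_space \<X>)"
    and "Y \<in> measurable N (count_space {-1, 1})"
    and "measure N {\<omega> \<in> space N. Y \<omega> = -1} > 0"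
    and "m \<ge> 2"
    and "\<forall>j\<in>{1..m}. classifier \<X> (h j)"
    and "n \<ge> 1"
    and "iid_sample N (P_neg \<X> N X Y) n S"
    and "0 < \<delta>" "\<delta> < 1" "0 < \<alpha>" "\<alpha> < 1" "L > 0"
    and "convex_surrogate \<phi>"
    and "L-lipschitz_on {-1..1} \<phi>"
  shows "(\<forall>g. (\<forall>\<omega>\<in>space N. g \<omega> \<in> H_conv m h) \<longrightarrow>
            (\<exists>E\<in>sets N. measure N E \<ge> 1 - \<delta> \<and>
              (\<forall>\<omega>\<in>E. emp_phi_type1_error \<phi> n (\<lambda>i. S i \<omega>) (g \<omega>) \<le> alpha_kappa \<alpha> L m \<delta> n \<longrightarrow>
                 type1_error N X Y (g \<omega>) \<le> phi_type1_error \<phi> N X Y (g \<omega>) \<and>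
                 phi_type1_error \<phi> N X Y (g \<omega>) \<le> \<alpha>)))
       \<and> measure N {\<omega> \<in> space N.
            H_phi_emp \<phi> n (\<lambda>i. S i \<omega>) m h (alpha_kappa \<alpha> L m \<delta> n) \<subseteq> H_phi \<phi> N X Y m h \<alpha>} \<ge> 1 - \<delta>"
proof -
  interpret prob_space N by fact
  note N = assms(1-4)
  note \<phi> = \<open>L-lipschitz_on {-1..1} \<phi>\<close>
  let ?D = "P_neg \<X> N X Y"
  let ?W = "padded_simplex m"
  let ?u = "conv_comb m h"
  let ?emp = "\<lambda>w \<omega>. emp_phi_type1_error \<phi> n (\<lambda>i. S i \<omega>) (?u w)"
  let ?R = "\<lambda>w. \<integral>x. \<phi> (?u w x) \<partial>?D"
  interpret D: prob_space ?D
    using N(1,2,4) by (rule prob_space_P_neg)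
  have space: "space ?D = \<X>"
    by (simp add: P_neg_def space_restrict_space)
  have hm: "h j \<in> borel_measurable ?D" if "j \<in> {1..m}" for j
    using assms(6) that by (simp add: classifier_def P_neg_def)
  have h1: "\<bar>h j x\<bar> \<le> 1" if "j \<in> {1..m}" "x \<in> space ?D" for j x
    using assms(6) that unfolding space by (force simp: classifier_def abs_le_iff)
  have Sm: "S i \<in> measurable N ?D" if "i \<in> {1..n}" for i
    using assms(8) that by (auto simp: iid_sample_def indep_vars_def2)
  have hS: "\<bar>h j (S i \<omega>)\<bar> \<le> 1" if "\<omega> \<in> space N" "i \<in> {1..n}" "j \<in> {1..m}" for i j \<omega>
    using h1[OF that(3)] measurable_space[OF Sm[OF that(2)] that(1)] .
  have W: "w \<in> simplex_weights m" if "w \<in> ?W" for w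
    using that padded_simplex_subset by blast
  have cl: "classifier \<X> (?u w)" if "w \<in> ?W" for w
    using assms(6) W[OF that] by (rule classifier_conv_comb)
  have \<phi>m: "(\<lambda>x. \<phi> (?u w x)) \<in> borel_measurable ?D" if w: "w \<in> ?W" for w
  proof (rule borel_measurable_lipschitz_comp[OF \<phi>])
    show "?u w \<in> borel_measurable ?D"
      using cl[OF w] by (simp add: classifier_def P_neg_def)
  qed (use W[OF w] h1 in \<open>auto intro: abs_conv_comb_le\<close>)
  have risk: "phi_type1_error \<phi> N X Y (?u w) = ?R w" if "w \<in> ?W" for w
    using phi_type1_error_eq_P_neg[OF N cl[OF that]] assms(14) by simp
  have R_diff: "\<bar>?R w - ?R v\<bar> \<le> L * (\<Sum>j=1..m. \<bar>w j - v j\<bar>)" if "w \<in> ?W" "v \<in> ?W" for w v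
    using W that hm h1 by (intro D.expectation_conv_comb_diff_le[OF \<phi>]) auto
  have emp_diff: "\<bar>?emp w \<omega> - ?emp v \<omega>\<bar> \<le> L * (\<Sum>j=1..m. \<bar>w j - v j\<bar>)"
    if "w \<in> ?W" "v \<in> ?W" "\<omega> \<in> space N" for w v \<omega>
    using W that hS \<open>n \<ge> 1\<close> by (intro emp_phi_conv_comb_diff_le[OF \<phi>]) auto

  define t where "t = kappa L m \<delta> / sqrt (real n) / 2"
  have "1 < 2 * real m / \<delta>"
    using assms(5,9,10) by (simp add: field_simps)
  then have t: "0 < t"
    using assms(7,13) by (simp add: t_def kappa_def)
  \<comment> \<open>With radius \<open>t / (2 * L)\<close>, moving to the net changes the true and
    the empirical error by at most \<open>t / 2\<close> each.\<close>
  obtain T where T: "finite T" "T \<subseteq> ?W"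
    and net: "\<And>w. w \<in> ?W \<Longrightarrow> \<exists>v\<in>T. (\<Sum>j=1..m. \<bar>w j - v j\<bar>) < t / (2 * L)"
    using padded_simplex_net[of "t / (2 * L)" m] t \<open>L > 0\<close> by auto
  let ?P = "\<Pi>\<^sub>M i\<in>{1..n}. ?D"
  let ?B = "{x \<in> space ?P. \<exists>w\<in>T. real n * t \<le> (\<Sum>i=1..n. ?R w - \<phi> (?u w (x i)))}"
  let ?S = "\<lambda>\<omega>. \<lambda>i\<in>{1..n}. S i \<omega>"
  have S: "?S \<in> measurable N ?P"
    using Sm by (intro measurable_restrict) auto
  have "(\<lambda>x. \<Sum>i=1..n. ?R w - \<phi> (?u w (x i))) \<in> borel_measurable ?P" if "w \<in> T" for w
  proof -
    have [measurable]: "(\<lambda>x. \<phi> (?u w x)) \<in> borel_measurable ?D"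
      using T that by (intro \<phi>m) auto
    show ?thesis
      by (intro borel_measurable_sum borel_measurable_diff borel_measurable_const
          measurable_compose[OF measurable_component_singleton]) auto
  qed
  then have B: "?B \<in> sets ?P"
    using T by (intro sets.sets_Collect_finite_Ex borel_measurable_le) auto
  \<comment> \<open>\<open>E\<close> does not mention \<open>g\<close>, so this one event serves
    every data-dependent classifier, and no measurability of \<open>g\<close> enters.\<close>
  define E where "E = space N - ?S -` ?B \<inter> space N"
  have E: "E \<in> sets N"
    using measurable_sets[OF S B] by (auto simp: E_def)
  have "emeasure N (?S -` ?B \<inter> space N) = emeasure (distr N ?P ?S) ?B"
    using emeasure_distr[OF S B] by simp
  also have "\<dots> = emeasure ?P ?B"
    using iid_sample_distr_PiM[OF assms(8,7)] by simp
  also have "\<dots> \<le> ennreal \<delta>"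
    unfolding t_def
  proof (rule D.conv_comb_deviation[OF \<phi>])
    show "T \<subseteq> simplex_weights m"
      using T(2) padded_simplex_subset by blast
  qed (use assms(5,7,9,10,13) T(1) hm h1 in simp_all)
  finally have "prob (?S -` ?B \<inter> space N) \<le> \<delta>"
    using assms(9) by (simp add: emeasure_eq_measure)
  then have prob_E: "1 - \<delta> \<le> prob E"
    unfolding E_def using prob_compl[OF measurable_sets[OF S B]] by simp
  have good: "?R w \<le> \<alpha>" if \<omega>E: "\<omega> \<in> E" and w: "w \<in> ?W"
    and le: "?emp w \<omega> \<le> alpha_kappa \<alpha> L m \<delta> n" for \<omega> w
  proof -
    have \<omega>: "\<omega> \<in> space N"
      using \<omega>E by (simp add: E_def)
    obtain v where v: "v \<in> T" "(\<Sum>j=1..m. \<bar>w j - v j\<bar>) < t / (2 * L)"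
      using net[OF w] by blast
    then have vW: "v \<in> ?W" and d: "L * (\<Sum>j=1..m. \<bar>w j - v j\<bar>) \<le> t / 2"
      using T \<open>L > 0\<close> by (auto simp: field_simps)
    have "(\<Sum>i=1..n. ?R v - \<phi> (?u v (?S \<omega> i))) < real n * t"
      using \<omega>E v(1) measurable_space[OF S \<omega>] by (auto simp: E_def not_le)
    also have "(\<Sum>i=1..n. ?R v - \<phi> (?u v (?S \<omega> i))) = real n * (?R v - ?emp v \<omega>)"
      using \<open>n \<ge> 1\<close> by (simp add: emp_phi_type1_error_def sum_subtractf right_diff_distrib)
    finally have "?R v - ?emp v \<omega> < t"
      using \<open>n \<ge> 1\<close> by simp
    \<comment> \<open>The deviation at \<open>v\<close> contributes \<open>t\<close> and the two
      changes between \<open>w\<close> and \<open>v\<close> contribute \<open>t / 2\<close> each;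
      the total \<open>2 * t\<close> is exactly the margin
      \<open>kappa L m \<delta> / sqrt (real n)\<close> subtracted in
      \<open>alpha_kappa\<close>.\<close>
    then have "?R w - ?emp w \<omega> \<le> 2 * t"
      using R_diff[OF w vW] emp_diff[OF w vW \<omega>] d by linarith
    then show ?thesis
      using le by (simp add: alpha_kappa_def t_def)
  qed
  let ?I = "{\<omega> \<in> space N. \<forall>w\<in>?W. ?emp w \<omega> \<le> alpha_kappa \<alpha> L m \<delta> n \<longrightarrow> ?R w \<le> \<alpha>}"
  have "?I \<in> sets N"
  proof (rule measurable_forall_le_imp_le_compact[OF compact_padded_simplex])
    show "continuous_on ?W ?R"
      using R_diff by (rule continuous_on_l1_lipschitz)
    show "continuous_on ?W (\<lambda>w. ?emp w \<omega>)" if "\<omega> \<in> space N" for \<omega>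
      using emp_diff[OF _ _ that] by (rule continuous_on_l1_lipschitz)
    show "?emp w \<in> borel_measurable N" if "w \<in> ?W" for w
      unfolding emp_phi_type1_error_def
      by (intro borel_measurable_divide borel_measurable_const borel_measurable_sum
          measurable_compose[OF Sm \<phi>m[OF that]])
  qed
  moreover have "E \<subseteq> ?I"
    using good by (auto simp: E_def)
  ultimately have "1 - \<delta> \<le> prob ?I"
    using prob_E finite_measure_mono by (meson order_trans)
  also have "?I = {\<omega> \<in> space N.
      H_phi_emp \<phi> n (\<lambda>i. S i \<omega>) m h (alpha_kappa \<alpha> L m \<delta> n) \<subseteq> H_phi \<phi> N X Y m h \<alpha>}"
    using risk by (auto simp: H_phi_emp_def H_phi_def H_conv_eq_padded)
  finally have incl: "1 - \<delta> \<le> prob {\<omega> \<in> space N.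
      H_phi_emp \<phi> n (\<lambda>i. S i \<omega>) m h (alpha_kappa \<alpha> L m \<delta> n) \<subseteq> H_phi \<phi> N X Y m h \<alpha>}" .
  have "type1_error N X Y (g \<omega>) \<le> phi_type1_error \<phi> N X Y (g \<omega>) \<and> phi_type1_error \<phi> N X Y (g \<omega>) \<le> \<alpha>"
    if g: "\<forall>\<omega>\<in>space N. g \<omega> \<in> H_conv m h" and \<omega>: "\<omega> \<in> E"
      and le: "emp_phi_type1_error \<phi> n (\<lambda>i. S i \<omega>) (g \<omega>) \<le> alpha_kappa \<alpha> L m \<delta> n" for g \<omega>
  proof -
    have "g \<omega> \<in> H_conv m h"
      using g \<omega> by (simp add: E_def)
    then obtain w where w: "w \<in> ?W" "g \<omega> = ?u w"
      by (auto simp: H_conv_eq_padded)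
    show ?thesis
      using type1_error_le_phi_type1_error[OF N cl[OF w(1)] assms(14) \<phi>] good[OF \<omega> w(1)] le risk[OF w(1)]
      by (simp add: w(2))
  qed
  then show ?thesis
    using E prob_E incl by blast
qed

end
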